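(* Let $A_2\in\mathbf{C}^{n\times n}$, $B_2\in\mathbf{C}^{n\times m}$, and let $Q\in\mathbf{C}^{n\times n}$, $R\in\mathbf{C}^{m\times m}$ be positive definite (Hermitian). Consider the antilinear system $$x(k+1)=A_2^{\#}x^{\#}(k)+B_2^{\#}u^{\#}(k),\qquad x(0)=x_0\in\mathbf{C}^n,$$ and the cost $J(u)=\sum_{k=0}^{\infty}\left(x^{\mathrm H}(k)Qx(k)+u^{\mathrm H}(k)Ru(k)\right)$. Define $$\begin{aligned}A_N&=A_2^{\#}\left(I_n-B_2\left(R+B_2^{\mathrm H}Q^{\#}B_2\right)^{-1}B_2^{\mathrm H}Q^{\#}\right)A_2,\qquad B_N=\begin{bmatrix}B_2^{\#}&A_2^{\#}B_2\end{bmatrix},\\ Q_N&=Q+A_2^{\mathrm H}\left(Q^{-\#}+B_2R^{-1}B_2^{\mathrm H}\right)^{-1}A_2,\qquad R_N=\begin{bmatrix}R^{\#}&0\\0&R+B_2^{\mathrm H}Q^{\#}B_2\end{bmatrix}.\end{aligned}$$ Then the following three statements are equivalent: 1. The LQR problem associated with this antilinear system has a solution. 2. The antilinear system is stabilizable, namely, $$\mathrm{rank}\begin{bmatrix}\lambda I_n-A_2A_2^{\#}&B_2&A_2B_2^{\#}\end{bmatrix}=n\quad\text{for all }\lambda\in\mathbf{C}\text{ with }|\lambda|\ge 1.$$ 3. There is a unique positive definite solution $P_N$ to the normal Riccati equation $$-Q_N=A_N^{\mathrm H}P_NA_N-P_N-A_N^{\mathrm H}P_NB_N\left(R_N+B_N^{\mathrm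 H}P_NB_N\right)^{-1}B_N^{\mathrm H}P_NA_N.$$ In this case, the optimal controller is the normal state feedback $u(k)=K_1^{\ast}x(k)$ with $$K_1^{\ast}=-\left(\left(R+B_2^{\mathrm H}Q^{\#}B_2\right)^{-1}B_2^{\mathrm H}Q^{\#}A_2+\begin{bmatrix}0&I_m\end{bmatrix}\left(R_N+B_N^{\mathrm H}P_NB_N\right)^{-1}B_N^{\mathrm H}P_NA_N\right),$$ the closed-loop system is asymptotically stable, and the minimal value of $J(u)$ is $J_{\min}(u)=x_0^{\mathrm H}P_Nx_0$.
   Context: For a complex matrix $M$, $M^{\#}$, $M^{\mathrm T}$, $M^{\mathrm H}$ denote its (entrywise) conjugate, transpose and conjugate transpose, and $M^{-\#}=(M^{-1})^{\#}=(M^{\#})^{-1}$. Positive definite matrices are Hermitian. LQR problem: find a control sequence $u^{\ast}$, $u(k)\in\mathbf{C}^m$, minimizing $J(u)$ along the trajectories of the system; the LQR problem is solvable (has a solution) if, for every initial condition $x_0\in\mathbf{C}^n$, the minimal value $J_{\min}(u^{\ast})$ is finite. Stabilizability: the antilinear system is stabilizable if there exist $K_1,K_2\in\mathbf{C}^{m\times n}$ such that the feedback $u(k)=K_1x(k)+K_2^{\#}x^{\#}(k)$ makes the closed-loop system asymptotically stable. (It is a known fact, recalled by the paper, that this is equivalent to the rank condition displayed in item 2.) *)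

theory Defs
  imports "HOL-Analysis.Analysis"
begin

definition vcnj :: "complex^'n \<Rightarrow> complex^'n" where
  "vcnj x = (\<chi> i. cnj (x $ i))"

abbreviation mcnj :: "complex^'m^'n \<Rightarrow> complex^'m^'n" where
  "mcnj M \<equiv> map_matrix cnj M"

abbreviation herm :: "complex^'m^'n \<Rightarrow> complex^'n^'m" where
  "herm M \<equiv> transpose (mcnj M)"

definition sesq :: "complex^'n^'n \<Rightarrow> complex^'n \<Rightarrow> complex" where
  "sesq M x = (\<Sum>i\<in>UNIV. cnj (x $ i) * (M *v x) $ i)"

text \<open>For a Hermitian \<open>M\<close> the value \<open>sesq M x\<close> is real, so taking the real part loses nothing.\<close>

definition pos_def :: "complex^'n^'n \<Rightarrow> bool" where
  "pos_def M \<longleftrightarrow> herm M = M \<and> (\<forall>x. x \<noteq> 0 \<longrightarrow> 0 < Re (sesq M x))"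

text \<open>Block matrices are indexed by sum types: the columns of \<open>hblock X Y\<close> are those
  of \<open>X\<close> (under \<open>Inl\<close>) followed by those of \<open>Y\<close> (under \<open>Inr\<close>).\<close>

definition hblock :: "'c^'a^'n \<Rightarrow> 'c^'b^'n \<Rightarrow> 'c^('a + 'b)^'n" where
  "hblock X Y = (\<chi> i j. case j of Inl a \<Rightarrow> X $ i $ a | Inr b \<Rightarrow> Y $ i $ b)"

definition diag_block :: "'c::zero^'a^'a \<Rightarrow> 'c^'b^'b \<Rightarrow> 'c^('a + 'b)^('a + 'b)" where
  "diag_block X Y =
     (\<chi> i. case i of Inl a \<Rightarrow> hblock X 0 $ a | Inr b \<Rightarrow> hblock 0 Y $ b)"

definition antilin_step ::
  "complex^'n^'n \<Rightarrow> complex^'m^'n \<Rightarrow> complex^'n \<Rightarrow> complex^'m \<Rightarrow> complex^'n" where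
  "antilin_step A B x u = mcnj A *v vcnj x + mcnj B *v vcnj u"

primrec traj ::
  "complex^'n^'n \<Rightarrow> complex^'m^'n \<Rightarrow> complex^'n \<Rightarrow> (nat \<Rightarrow> complex^'m) \<Rightarrow> nat \<Rightarrow> complex^'n" where
  "traj A B x0 u 0 = x0"
| "traj A B x0 u (Suc k) = antilin_step A B (traj A B x0 u k) (u k)"

text \<open>The cost is extended-valued. The summands are nonnegative reals when \<open>Q\<close> and \<open>R\<close> are
  positive definite, so the truncation in \<open>ennreal\<close> has no effect.\<close>

definition lqr_cost ::
  "complex^'n^'n \<Rightarrow> complex^'m^'n \<Rightarrow> complex^'n^'n \<Rightarrow> complex^'m^'m \<Rightarrow>
   complex^'n \<Rightarrow> (nat \<Rightarrow> complex^'m) \<Rightarrow> ennreal" where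
  "lqr_cost A B Q R x0 u =
     (\<Sum>k. ennreal (Re (sesq Q (traj A B x0 u k) + sesq R (u k))))"

definition lqr_optimal ::
  "complex^'n^'n \<Rightarrow> complex^'m^'n \<Rightarrow> complex^'n^'n \<Rightarrow> complex^'m^'m \<Rightarrow>
   complex^'n \<Rightarrow> (nat \<Rightarrow> complex^'m) \<Rightarrow> bool" where
  "lqr_optimal A B Q R x0 u \<longleftrightarrow> (\<forall>v. lqr_cost A B Q R x0 u \<le> lqr_cost A B Q R x0 v)"

definition lqr_solvable ::
  "complex^'n^'n \<Rightarrow> complex^'m^'n \<Rightarrow> complex^'n^'n \<Rightarrow> complex^'m^'m \<Rightarrow> bool" where
  "lqr_solvable A B Q R \<longleftrightarrow>
     (\<forall>x0. \<exists>u. lqr_optimal A B Q R x0 u \<and> lqr_cost A B Q R x0 u < \<infinity>)"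

text \<open>Lyapunov stability together with global attractivity of the equilibrium \<open>0\<close> of
  \<open>x(k+1) = f (x(k))\<close>.\<close>

definition asymptotically_stable :: "('a::real_normed_vector \<Rightarrow> 'a) \<Rightarrow> bool" where
  "asymptotically_stable f \<longleftrightarrow>
     (\<forall>e>0. \<exists>d>0. \<forall>x0. norm x0 < d \<longrightarrow> (\<forall>k. norm ((f ^^ k) x0) < e)) \<and>
     (\<forall>x0. (\<lambda>k. (f ^^ k) x0) \<longlonglongrightarrow> 0)"

definition closed_loop ::
  "complex^'n^'n \<Rightarrow> complex^'m^'n \<Rightarrow> (complex^'n \<Rightarrow> complex^'m) \<Rightarrow> complex^'n \<Rightarrow> complex^'n" where
  "closed_loop A B F x = antilin_step A B x (F x)"

definition stabilizable :: "complex^'n^'n \<Rightarrow> complex^'m^'n \<Rightarrow> bool" where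
  "stabilizable A B \<longleftrightarrow>
     (\<exists>K1 K2. asymptotically_stable (closed_loop A B (\<lambda>x. K1 *v x + mcnj K2 *v vcnj x)))"

definition stabilizability_rank_cond :: "complex^'n^'n \<Rightarrow> complex^'m^'n \<Rightarrow> bool" where
  "stabilizability_rank_cond A B \<longleftrightarrow>
     (\<forall>z::complex. cmod z \<ge> 1 \<longrightarrow>
        rank (hblock (hblock (mat z - A ** mcnj A) B) (A ** mcnj B)) = CARD('n))"

definition S_mat ::
  "complex^'m^'n \<Rightarrow> complex^'n^'n \<Rightarrow> complex^'m^'m \<Rightarrow> complex^'m^'m" where
  "S_mat B Q R = R + herm B ** mcnj Q ** B"

definition A_N ::
  "complex^'n^'n \<Rightarrow> complex^'m^'n \<Rightarrow> complex^'n^'n \<Rightarrow> complex^'m^'m \<Rightarrow> complex^'n^'n" where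
  "A_N A B Q R =
     mcnj A ** (mat 1 - B ** matrix_inv (S_mat B Q R) ** herm B ** mcnj Q) ** A"

definition B_N :: "complex^'n^'n \<Rightarrow> complex^'m^'n \<Rightarrow> complex^('m + 'm)^'n" where
  "B_N A B = hblock (mcnj B) (mcnj A ** B)"

definition Q_N ::
  "complex^'n^'n \<Rightarrow> complex^'m^'n \<Rightarrow> complex^'n^'n \<Rightarrow> complex^'m^'m \<Rightarrow> complex^'n^'n" where
  "Q_N A B Q R =
     Q + herm A ** matrix_inv (mcnj (matrix_inv Q) + B ** matrix_inv R ** herm B) ** A"

definition R_N ::
  "complex^'m^'n \<Rightarrow> complex^'n^'n \<Rightarrow> complex^'m^'m \<Rightarrow> complex^('m + 'm)^('m + 'm)" where
  "R_N B Q R = diag_block (mcnj R) (S_mat B Q R)"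

definition riccati_gain ::
  "complex^'n^'n \<Rightarrow> complex^'m^'n \<Rightarrow> complex^'n^'n \<Rightarrow> complex^'m^'m \<Rightarrow>
   complex^'n^'n \<Rightarrow> complex^'n^('m + 'm)" where
  "riccati_gain A B Q R P =
     matrix_inv (R_N B Q R + herm (B_N A B) ** P ** B_N A B)
       ** herm (B_N A B) ** P ** A_N A B Q R"

definition normal_riccati ::
  "complex^'n^'n \<Rightarrow> complex^'m^'n \<Rightarrow> complex^'n^'n \<Rightarrow> complex^'m^'m \<Rightarrow> complex^'n^'n \<Rightarrow> bool" where
  "normal_riccati A B Q R P \<longleftrightarrow>
     - Q_N A B Q R =
       herm (A_N A B Q R) ** P ** A_N A B Q R - P
       - herm (A_N A B Q R) ** P ** B_N A B ** riccati_gain A B Q R P"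

definition K1_opt ::
  "complex^'n^'n \<Rightarrow> complex^'m^'n \<Rightarrow> complex^'n^'n \<Rightarrow> complex^'m^'m \<Rightarrow>
   complex^'n^'n \<Rightarrow> complex^'n^'m" where
  "K1_opt A B Q R P =
     - (matrix_inv (S_mat B Q R) ** herm B ** mcnj Q ** A
        + (hblock 0 (mat 1) :: complex^('m + 'm)^'m) ** riccati_gain A B Q R P)"

end

theory Submission
  imports Defs "HOL-Computational_Algebra.Fundamental_Theorem_Algebra"
begin

text \<open>
  The system is \<open>x(k+1) = (A x(k) + B u(k))\<^sup>#\<close>. Its one-step dynamic programming operator
  \<open>riccati\<close> sends the Hermitian form \<open>P\<close> to the minimum over \<open>u\<close> of the stage cost plus \<open>P\<close> at the
  next state. Two steps of the system are linear with inputs \<open>u(k+1)\<^sup>#\<close> and \<open>u(k)\<close>, and after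
  completing the square in \<open>u(k)\<close> the normal Riccati equation says exactly
  \<open>riccati (riccati P) = P\<close>.

  If \<open>P\<close> is such a solution, the cost of every control of finite cost is the value of \<open>P\<close> at the
  initial state plus a sum of squares that vanishes only for the feedback law. So \<open>P\<close> is the optimal
  cost; it is therefore unique, satisfies \<open>riccati P = P\<close>, and the feedback is stabilizing. If every
  initial state admits a control of finite cost, the iterates of \<open>riccati\<close> increase to a solution.

  A left null vector of the rank matrix for \<open>\<bar>z\<bar> \<ge> 1\<close> is a mode that no control can bring to \<open>0\<close>.
  Conversely, the states that can be steered to \<open>0\<close> geometrically form an invariant complex subspace
  that contains the range of the input map. On a nonzero quotient, the two-step drift has an
  eigenvalue \<open>z\<close>; the rank condition forces \<open>\<bar>z\<bar> < 1\<close>, and then the eigenvector is steerable.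
\<close>

section \<open>Hermitian forms\<close>

lemma vcnj_nth [simp]: "vcnj x $ i = cnj (x $ i)"
  by (simp add: vcnj_def)

lemma vcnj_vcnj [simp]: "vcnj (vcnj x) = x"
  by (simp add: vec_eq_iff)

lemma vcnj_add: "vcnj (x + y) = vcnj x + vcnj y"
  by (simp add: vec_eq_iff)

lemma vcnj_diff: "vcnj (x - y) = vcnj x - vcnj y"
  by (simp add: vec_eq_iff)

lemma vcnj_0 [simp]: "vcnj 0 = 0"
  by (simp add: vec_eq_iff)

lemma vcnj_smult: "vcnj (c *s x) = cnj c *s vcnj x"
  by (simp add: vec_eq_iff)

lemma norm_smult: "norm (c *s x) = cmod c * norm (x :: complex^'n)"
  by (simp add: norm_vec_def norm_mult L2_set_right_distrib)

lemma vcnj_mv: "vcnj (M *v x) = mcnj M *v vcnj x"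
  by (simp add: vec_eq_iff matrix_vector_mult_def)

lemma mcnj_mcnj [simp]: "mcnj (mcnj M) = M"
  by (simp add: vec_eq_iff)

lemma mcnj_mult: "mcnj (M ** N) = mcnj M ** mcnj N"
  by (simp add: vec_eq_iff matrix_matrix_mult_def)

lemma herm_herm [simp]: "herm (herm M) = M"
  by (simp add: vec_eq_iff transpose_def)

lemma herm_mult: "herm (M ** N) = herm N ** herm M"
  by (simp add: mcnj_mult matrix_transpose_mul)

lemma herm_add: "herm (M + N) = herm M + herm N"
  by (simp add: vec_eq_iff transpose_def)

lemma herm_diff: "herm (M - N) = herm M - herm N"
  by (simp add: vec_eq_iff transpose_def)

lemma herm_mcnj: "herm (mcnj M) = mcnj (herm M)"
  by (simp add: vec_eq_iff transpose_def)

lemma matrix_add_rdistrib: "(A + B) ** C = A ** C + B ** (C :: 'a::semiring_1^'p^'n)"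
  by (simp add: vec_eq_iff matrix_matrix_mult_def distrib_right sum.distrib)

lemma matrix_diff_ldistrib: "A ** (B - C) = A ** B - A ** (C :: 'a::ring_1^'p^'n)"
  by (simp add: vec_eq_iff matrix_matrix_mult_def right_diff_distrib sum_subtractf)

lemma matrix_diff_rdistrib: "(A - B) ** C = A ** C - B ** (C :: 'a::ring_1^'p^'n)"
  by (simp add: vec_eq_iff matrix_matrix_mult_def left_diff_distrib sum_subtractf)

lemma mv_smult: "M *v (c *s x) = c *s (M *v (x :: 'a::comm_semiring_1^'n))"
  by (simp add: vec_eq_iff matrix_vector_mult_def sum_distrib_left mult_ac)

lemma minus_mv: "(- M) *v x = - (M *v (x :: 'a::ring_1^'n))"
  by (simp add: vec_eq_iff matrix_vector_mult_def sum_negf)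

lemma matrix_inv_right_left:
  assumes "invertible M"
  shows "M ** matrix_inv M = mat 1" "matrix_inv M ** M = mat 1"
  using someI_ex[OF assms[unfolded invertible_def]] by (simp_all add: matrix_inv_def)

lemma matrix_inv_unique:
  assumes "M ** N = mat 1" "N ** M = mat (1 :: 'a :: semiring_1)"
  shows "matrix_inv M = N"
proof -
  have i: "invertible M" using assms by (auto simp: invertible_def)
  have "matrix_inv M = N ** (M ** matrix_inv M)"
    by (simp only: matrix_mul_assoc assms matrix_mul_lid)
  then show ?thesis by (simp add: matrix_inv_right_left[OF i])
qed

section \<open>Inner product and the forms it induces\<close>

definition cip :: "complex^'n \<Rightarrow> complex^'n \<Rightarrow> complex" where
  "cip x y = (\<Sum>i\<in>UNIV. cnj (x $ i) * y $ i)"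

lemma sesq_cip: "sesq M x = cip x (M *v x)"
  by (simp add: sesq_def cip_def)

lemma cip_add_left: "cip (x + y) z = cip x z + cip y z"
  and cip_add_right: "cip z (x + y) = cip z x + cip z y"
  and cip_diff_left: "cip (x - y) z = cip x z - cip y z"
  and cip_diff_right: "cip z (x - y) = cip z x - cip z y"
  and cip_minus_left: "cip (- x) z = - cip x z"
  and cip_minus_right: "cip z (- x) = - cip z x"
  and cip_smult_left: "cip (c *s x) z = cnj c * cip x z"
  and cip_smult_right: "cip z (c *s x) = c * cip z x"
  and cip_0_left [simp]: "cip 0 z = 0"
  and cip_0_right [simp]: "cip z 0 = 0"
  by (simp_all add: cip_def ring_distribs sum.distrib sum_subtractf sum_negf sum_distrib_left mult_ac)

lemmas cip_simps = cip_add_left cip_add_right cip_diff_left cip_diff_right cip_minus_left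
  cip_minus_right

lemma cip_commute: "cip y x = cnj (cip x y)"
  by (simp add: cip_def mult.commute)

lemma cip_vcnj: "cip (vcnj x) (vcnj y) = cnj (cip x y)"
  by (simp add: cip_def)

lemma cip_adjoint: "cip x (M *v y) = cip (herm M *v x) y"
proof -
  have "cip x (M *v y) = (\<Sum>i\<in>UNIV. \<Sum>j\<in>UNIV. cnj (x $ i) * (M $ i $ j * y $ j))"
    by (simp add: cip_def matrix_vector_mult_def sum_distrib_left)
  also have "\<dots> = (\<Sum>j\<in>UNIV. \<Sum>i\<in>UNIV. cnj (x $ i) * (M $ i $ j * y $ j))"
    by (rule sum.swap)
  also have "\<dots> = cip (herm M *v x) y"
    by (simp add: cip_def matrix_vector_mult_def transpose_def sum_distrib_left sum_distrib_right mult_ac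
        del: transpose_matrix_vector)
  finally show ?thesis .
qed

lemma sesq_mcnj: "sesq (mcnj M) x = cnj (sesq M (vcnj x))"
  using cip_vcnj[of "vcnj x" "M *v vcnj x"] by (simp add: sesq_cip vcnj_mv)

lemma sesq_hermitian_real:
  assumes "herm M = M"
  shows "cnj (sesq M x) = sesq M x"
  by (metis assms cip_adjoint cip_commute sesq_cip)

lemma sesq_vcnj:
  assumes "herm M = M"
  shows "sesq M (vcnj x) = sesq (mcnj M) x"
  using sesq_mcnj[of M x] sesq_hermitian_real[OF assms, of "vcnj x"] by simp

lemma sesq_add_mat: "sesq (M + N) x = sesq M x + sesq N x"
  by (simp add: sesq_cip matrix_vector_mult_add_rdistrib cip_simps)

lemma sesq_diff_mat: "sesq (M - N) x = sesq M x - sesq N x"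
  by (simp add: sesq_cip matrix_vector_mult_diff_rdistrib cip_simps)

lemma sesq_congruence: "sesq (herm N ** M ** N) x = sesq M (N *v x)"
  by (simp add: sesq_cip cip_adjoint[of x] matrix_vector_mul_assoc[symmetric] cip_adjoint[of "N *v x"]
      herm_herm del: transpose_matrix_vector)

lemma sesq_0 [simp]: "sesq 0 x = 0" "sesq M 0 = 0"
  by (simp_all add: sesq_cip)

lemma sesq_smult: "sesq M (c *s x) = of_real ((cmod c)\<^sup>2) * sesq M x"
  by (simp add: sesq_cip mv_smult cip_smult_left cip_smult_right complex_norm_square mult_ac
      del: of_real_power)

lemma pos_def_hermitian: "pos_def M \<Longrightarrow> herm M = M"
  by (simp add: pos_def_def)

lemma pos_def_ge_0: "pos_def M \<Longrightarrow> 0 \<le> Re (sesq M x)"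
  by (cases "x = 0") (auto simp: pos_def_def less_imp_le)

lemma pos_def_eq_0_iff: "pos_def M \<Longrightarrow> Re (sesq M x) = 0 \<longleftrightarrow> x = 0"
  by (cases "x = 0") (auto simp: pos_def_def less_imp_neq)

lemma pos_def_add:
  assumes "pos_def M" "herm N = N" "\<And>x. 0 \<le> Re (sesq N x)"
  shows "pos_def (M + N)"
  using assms by (simp add: pos_def_def sesq_add_mat herm_add add_pos_nonneg)

lemma pos_def_mcnj:
  assumes "pos_def M"
  shows "pos_def (mcnj M)"
  unfolding pos_def_def
proof (intro conjI allI impI)
  show "herm (mcnj M) = mcnj M"
    using assms by (simp only: herm_mcnj pos_def_hermitian)
  fix x :: "complex^'a" assume "x \<noteq> 0"
  then have "vcnj x \<noteq> 0" by (metis vcnj_0 vcnj_vcnj)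
  then show "0 < Re (sesq (mcnj M) x)"
    using assms by (simp add: sesq_mcnj pos_def_def)
qed

lemma pos_def_invertible:
  assumes "pos_def M"
  shows "invertible M"
proof -
  have "\<forall>x. M *v x = 0 \<longrightarrow> x = 0"
    using pos_def_eq_0_iff[OF assms] by (metis cip_0_right sesq_cip zero_complex.simps(1))
  then obtain N where N: "N ** M = mat 1"
    using matrix_left_invertible_ker by blast
  then have "M ** N = mat 1"
    by (simp add: matrix_left_right_inverse)
  with N show ?thesis by (auto simp: invertible_def)
qed

lemma mcnj_mat_1: "mcnj (mat 1) = mat 1"
  by (simp add: vec_eq_iff mat_def)

lemma herm_mat_1: "herm (mat 1) = mat 1"
  by (simp add: mcnj_mat_1)

lemma herm_matrix_inv:
  assumes "invertible M" "herm M = M"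
  shows "herm (matrix_inv M) = matrix_inv M"
proof (rule matrix_inv_unique[symmetric])
  show "M ** herm (matrix_inv M) = mat 1"
    using arg_cong[OF matrix_inv_right_left(2)[OF assms(1)], of herm]
    by (simp add: herm_mult assms(2) herm_mat_1)
  show "herm (matrix_inv M) ** M = mat 1"
    using arg_cong[OF matrix_inv_right_left(1)[OF assms(1)], of herm]
    by (simp add: herm_mult assms(2) herm_mat_1)
qed

lemma mcnj_matrix_inv:
  assumes "invertible M"
  shows "matrix_inv (mcnj M) = mcnj (matrix_inv M)"
  by (rule matrix_inv_unique)
    (simp_all add: mcnj_mult[symmetric] matrix_inv_right_left[OF assms] mcnj_mat_1)

text \<open>The form has a positive minimum on the compact unit sphere, and homogeneity of degree
  two carries the bound to all vectors.\<close>

lemma pos_def_lower_bound: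
  fixes M :: "complex^'n^'n"
  assumes "pos_def M"
  obtains q where "q > 0" "\<And>x. q * (norm x)\<^sup>2 \<le> Re (sesq M x)"
proof -
  have ne: "sphere (0 :: complex^'n) 1 \<noteq> {}"
    by simp
  have cont: "continuous_on (sphere 0 1) (\<lambda>x. Re (sesq M x))"
    unfolding sesq_def matrix_vector_mult_def by (intro continuous_intros)
  obtain z where z: "z \<in> sphere 0 1" "\<And>x. x \<in> sphere 0 1 \<Longrightarrow> Re (sesq M z) \<le> Re (sesq M x)"
    using continuous_attains_inf[OF compact_sphere ne cont] by blast
  have "z \<noteq> 0" using z by auto
  then have "Re (sesq M z) > 0" using assms by (simp add: pos_def_def)
  moreover have "Re (sesq M z) * (norm x)\<^sup>2 \<le> Re (sesq M x)" for x
  proof (cases "x = 0")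
    case False
    define y where "y = complex_of_real (1 / norm x) *s x"
    have yn: "norm y = 1"
      using False by (simp add: y_def norm_smult norm_divide)
    have "x = complex_of_real (norm x) *s y"
      using False by (simp add: y_def vector_smult_assoc)
    then have "sesq M x = of_real ((norm x)\<^sup>2) * sesq M y"
      by (metis abs_norm_cancel norm_of_real sesq_smult)
    moreover have "Re (sesq M z) \<le> Re (sesq M y)"
      using z(2)[of y] yn by simp
    ultimately show ?thesis
      by (simp add: mult.commute[of "Re (sesq M z)"] mult_left_mono del: of_real_power)
  qed simp
  ultimately show ?thesis using that by blast
qed

text \<open>Entrywise triangle inequality. The constant is crude, but it is continuous in
  \<open>M\<close> and vanishes at \<open>0\<close>, which the limit of the Riccati iterates
  needs.\<close>

lemma sesq_norm_le:
  "cmod (sesq M x) \<le> (\<Sum>i\<in>UNIV. \<Sum>j\<in>UNIV. cmod (M $ i $ j)) * (norm x)\<^sup>2" for x :: "complex^'n"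
proof -
  have "cmod (sesq M x) \<le> (\<Sum>i\<in>UNIV. \<Sum>j\<in>UNIV. norm x * (cmod (M $ i $ j) * norm x))"
    unfolding sesq_def matrix_vector_mult_def sum_distrib_left vec_lambda_beta
    by (auto intro!: norm_sum[THEN order_trans] sum_mono mult_mono Finite_Cartesian_Product.norm_nth_le
        simp: norm_mult)
  then show ?thesis by (simp add: sum_distrib_right sum_distrib_left power2_eq_square mult_ac)
qed

lemma mv_axis: "M *v axis j 1 = column j (M :: 'a::comm_semiring_1^'n^'m)"
  by (simp add: vec_eq_iff matrix_vector_mult_def column_def axis_def if_distrib cong: if_cong)

lemma cip_axis: "cip (axis i 1) y = y $ i"
  by (simp add: cip_def axis_def if_distrib if_distribR cong: if_cong)

text \<open>Complex polarization: four values of the form determine an entry, so equality and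
  convergence of matrices reduce to their forms.\<close>

lemma polarization:
  "M $ i $ j = (sesq M (axis i 1 + axis j 1) - sesq M (axis j 1 - axis i 1)
     + \<i> * sesq M (axis j 1 + \<i> *s axis i 1) - \<i> * sesq M (axis j 1 - \<i> *s axis i 1)) / 4"
  by (simp add: sesq_cip cip_simps mv_smult cip_smult_left cip_smult_right mv_axis cip_axis column_def
      matrix_vector_right_distrib matrix_vector_mult_diff_distrib algebra_simps)

lemma sesq_eqI:
  assumes "\<And>x. sesq M x = sesq N x"
  shows "M = N"
  by (simp add: vec_eq_iff polarization assms)

lemma hermitian_eqI:
  assumes "herm M = M" "herm N = N" "\<And>x. Re (sesq M x) = Re (sesq N x)"
  shows "M = N"
proof (rule sesq_eqI)
  fix x
  show "sesq M x = sesq N x"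
    using sesq_hermitian_real[OF assms(1), of x] sesq_hermitian_real[OF assms(2), of x] assms(3)[of x]
    by (auto simp: complex_eq_iff)
qed

lemma tendsto_sesq:
  fixes M :: "nat \<Rightarrow> complex^'n^'n"
  assumes "M \<longlonglongrightarrow> L"
  shows "(\<lambda>k. sesq (M k) x) \<longlonglongrightarrow> sesq L x"
  unfolding sesq_def matrix_vector_mult_def using assms
  by (auto intro!: tendsto_intros)

text \<open>Hermitian forms are real, so the real parts carry all of the form; polarization passes
  the limits on to the entries.\<close>

lemma convergent_hermitian:
  fixes M :: "nat \<Rightarrow> complex^'n^'n"
  assumes h: "\<And>k. herm (M k) = M k" and c: "\<And>x. convergent (\<lambda>k. Re (sesq (M k) x))"
  obtains L where "M \<longlonglongrightarrow> L"
proof -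
  have "convergent (\<lambda>k. sesq (M k) x)" for x
  proof -
    have eq: "(\<lambda>k. sesq (M k) x) = (\<lambda>k. of_real (Re (sesq (M k) x)))"
      using sesq_hermitian_real[OF h, of _ x] by (auto simp: complex_eq_iff)
    show ?thesis
      by (subst eq) (rule convergent_of_real[OF c])
  qed
  then obtain l where l: "\<And>x. (\<lambda>k. sesq (M k) x) \<longlonglongrightarrow> l x"
    unfolding convergent_def by metis
  have "M \<longlonglongrightarrow> (\<chi> i j. (l (axis i 1 + axis j 1) - l (axis j 1 - axis i 1)
     + \<i> * l (axis j 1 + \<i> *s axis i 1) - \<i> * l (axis j 1 - \<i> *s axis i 1)) / 4)"
  proof (intro vec_tendstoI)
    fix i j
    show "(\<lambda>k. M k $ i $ j) \<longlonglongrightarrow> (\<chi> i j. (l (axis i 1 + axis j 1) - l (axis j 1 - axis i 1)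
       + \<i> * l (axis j 1 + \<i> *s axis i 1) - \<i> * l (axis j 1 - \<i> *s axis i 1)) / 4) $ i $ j"
      unfolding polarization[of "M _"] vec_lambda_beta by (intro tendsto_intros l) simp
  qed
  then show ?thesis by (rule that)
qed

section \<open>Completing the square\<close>

text \<open>As a rewrite rule it would turn \<open>herm M *v x\<close> into a row-vector product,
  which \<open>cip_adjoint\<close> no longer matches.\<close>

declare transpose_matrix_vector [simp del]

text \<open>The optimal control is minus this gain times the state. The dimensions stay free so that
  both the one-step system and the two-step system with stacked inputs are instances.\<close>

definition lq_gain ::
  "complex^'k^'n \<Rightarrow> complex^'m^'n \<Rightarrow> complex^'m^'m \<Rightarrow> complex^'n^'n \<Rightarrow> complex^'k^'m" where
  "lq_gain A B R P = matrix_inv (R + herm B ** P ** B) ** herm B ** P ** A"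

text \<open>For positive definite weights this is, as a form in \<open>x\<close>, the minimum over
  \<open>u\<close> of \<open>sesq R u + sesq P (A *v x + B *v u)\<close>; as a matrix it is a Schur
  complement.\<close>

definition lq_reduce ::
  "complex^'k^'n \<Rightarrow> complex^'m^'n \<Rightarrow> complex^'m^'m \<Rightarrow> complex^'n^'n \<Rightarrow> complex^'k^'k" where
  "lq_reduce A B R P = herm A ** P ** A - herm A ** P ** B ** lq_gain A B R P"

lemma herm_congruence: "herm P = P \<Longrightarrow> herm (herm B ** P ** B) = herm B ** P ** B"
  by (simp add: herm_mult matrix_mul_assoc)

lemma pos_def_lq_weight:
  assumes "pos_def R" "pos_def P"
  shows "pos_def (R + herm B ** P ** B)"
  using assms by (intro pos_def_add)
    (simp_all add: pos_def_hermitian herm_congruence sesq_congruence pos_def_ge_0)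

text \<open>With \<open>S = R + herm B ** P ** B\<close>, the gain solves
  \<open>S ** lq_gain A B R P = herm B ** P ** A\<close>, so the mixed terms in \<open>x\<close> and
  \<open>u\<close> are those of the square weighted by \<open>S\<close>.\<close>

lemma complete_square:
  fixes A :: "complex^'k^'n" and B :: "complex^'m^'n"
  assumes R: "pos_def R" and P: "pos_def P"
  shows "sesq R u + sesq P (A *v x + B *v u) =
    sesq (lq_reduce A B R P) x + sesq (R + herm B ** P ** B) (u + lq_gain A B R P *v x)"
proof -
  define S where "S = R + herm B ** P ** B"
  define g where "g = lq_gain A B R P *v x"
  have S: "pos_def S" unfolding S_def using R P by (rule pos_def_lq_weight)
  have hS: "herm S = S" and hP: "herm P = P" using S P by (simp_all add: pos_def_hermitian)
  have "S ** lq_gain A B R P = herm B ** P ** A"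
    by (simp add: lq_gain_def S_def[symmetric] matrix_mul_assoc matrix_inv_right_left[OF pos_def_invertible[OF S]])
  then have Sg: "S *v g = herm B *v (P *v (A *v x))"
    by (simp add: g_def matrix_vector_mul_assoc matrix_mul_assoc)
  have BP: "cip y (herm B *v (P *v (A *v x))) = cip (B *v y) (P *v (A *v x))" for y
    by (simp add: cip_adjoint[of y])
  have PA: "cip z (P *v y) = cip (P *v z) y" for z y
    by (subst cip_adjoint) (simp only: hP)
  have SA: "cip z (S *v y) = cip (S *v z) y" for z y
    by (subst cip_adjoint) (simp only: hS)
  have "sesq (lq_reduce A B R P) x = cip (A *v x) (P *v (A *v x)) - cip (A *v x) (P *v (B *v g))"
    by (simp add: sesq_cip lq_reduce_def g_def matrix_vector_mult_diff_rdistrib cip_simps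
        matrix_vector_mul_assoc[symmetric] cip_adjoint[of x "herm A"])
  moreover have "cip (A *v x) (P *v (B *v g)) = cip g (S *v g)"
    by (subst SA, simp only: Sg) (simp only: PA cip_adjoint[of _ B])
  moreover have "cip (A *v x) (P *v (B *v u)) = cip g (S *v u)"
    by (simp only: SA Sg) (simp only: PA cip_adjoint[of _ B])
  moreover have "cip (B *v u) (P *v (A *v x)) = cip u (S *v g)"
    by (simp only: Sg BP)
  moreover have "cip u (S *v u) = sesq R u + cip (B *v u) (P *v (B *v u))"
    by (simp add: S_def sesq_cip matrix_vector_mult_add_rdistrib cip_simps
        matrix_vector_mul_assoc[symmetric] cip_adjoint[of u "herm B"])
  ultimately show ?thesis
    unfolding S_def[symmetric] g_def[symmetric]
    by (simp add: sesq_cip[of P] sesq_cip[of S] matrix_vector_right_distrib cip_simps)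
qed

lemma lq_reduce_hermitian:
  assumes "pos_def R" "pos_def P"
  shows "herm (lq_reduce A B R P) = lq_reduce A B R P"
proof -
  have S: "pos_def (R + herm B ** P ** B)" using assms by (rule pos_def_lq_weight)
  then have "herm (matrix_inv (R + herm B ** P ** B)) = matrix_inv (R + herm B ** P ** B)"
    by (intro herm_matrix_inv pos_def_invertible pos_def_hermitian)
  then show ?thesis
    using pos_def_hermitian[OF assms(2)]
    by (simp add: lq_reduce_def lq_gain_def herm_diff herm_mult matrix_mul_assoc)
qed

lemma lq_reduce_nonneg:
  assumes "pos_def R" "pos_def P"
  shows "0 \<le> Re (sesq (lq_reduce A B R P) x)"
proof -
  have "sesq (lq_reduce A B R P) x = sesq R (- (lq_gain A B R P *v x))
      + sesq P (A *v x + B *v (- (lq_gain A B R P *v x)))"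
    using complete_square[OF assms, of "- (lq_gain A B R P *v x)" A x B] by simp
  then show ?thesis using assms by (simp add: pos_def_ge_0)
qed

text \<open>Woodbury identity: the cancellation is \<open>R^-1 (T - R) T^-1 = R^-1 - T^-1\<close>
  with \<open>T - R = herm B ** Z ** B\<close>. It serves to recognize \<open>Q_N\<close> as a
  Riccati image.\<close>

lemma woodbury:
  fixes B :: "complex^'m^'n"
  assumes Z: "invertible Z" and R: "invertible R" and S: "invertible (R + herm B ** Z ** B)"
  shows "matrix_inv (matrix_inv Z + B ** matrix_inv R ** herm B) =
    Z - Z ** B ** matrix_inv (R + herm B ** Z ** B) ** herm B ** Z" (is "matrix_inv ?X = ?Y")
proof -
  define T where "T = R + herm B ** Z ** B"
  have BZB: "herm B ** Z ** B = T - R" by (simp add: T_def)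
  have "matrix_inv R ** (herm B ** Z ** B) ** matrix_inv T
      = matrix_inv R ** (T ** matrix_inv T) - (matrix_inv R ** R) ** matrix_inv T"
    by (simp only: BZB matrix_diff_ldistrib matrix_diff_rdistrib matrix_mul_assoc)
  then have eq: "matrix_inv R ** (herm B ** Z ** B) ** matrix_inv T = matrix_inv R - matrix_inv T"
    by (simp add: matrix_inv_right_left[OF R] matrix_inv_right_left[OF S[folded T_def]])
  have "B ** matrix_inv R ** herm B ** Z ** B ** matrix_inv T ** herm B ** Z
      = B ** (matrix_inv R ** (herm B ** Z ** B) ** matrix_inv T) ** herm B ** Z"
    by (simp only: matrix_mul_assoc)
  then have key: "B ** matrix_inv R ** herm B ** Z ** B ** matrix_inv T ** herm B ** Z
      = B ** (matrix_inv R - matrix_inv T) ** herm B ** Z"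
    unfolding eq .
  have "?X ** ?Y = mat 1"
    unfolding T_def[symmetric]
    using matrix_inv_right_left[OF Z]
    by (simp add: matrix_add_rdistrib matrix_diff_ldistrib matrix_mul_assoc key
        matrix_diff_rdistrib)
  then show ?thesis
    by (simp add: matrix_inv_unique matrix_left_right_inverse)
qed

section \<open>Block matrices\<close>

definition vjoin :: "'c^'a \<Rightarrow> 'c^'b \<Rightarrow> 'c^('a + 'b)" where
  "vjoin p q = (\<chi> i. case i of Inl a \<Rightarrow> p $ a | Inr b \<Rightarrow> q $ b)"

lemma sum_UNIV_Plus:
  "(\<Sum>i\<in>(UNIV :: ('a::finite + 'b::finite) set). f i) = (\<Sum>a\<in>UNIV. f (Inl a)) + (\<Sum>b\<in>UNIV. f (Inr b))"
  unfolding UNIV_Plus_UNIV[symmetric] by (subst sum.Plus) simp_all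

lemma vjoin_cases: obtains p q where "w = vjoin p q"
proof
  show "w = vjoin (\<chi> a. w $ Inl a) (\<chi> b. w $ Inr b)"
    by (simp add: vjoin_def vec_eq_iff split: sum.split)
qed

lemma vjoin_eq_0_iff: "vjoin p q = 0 \<longleftrightarrow> p = 0 \<and> q = 0"
  by (auto simp: vjoin_def vec_eq_iff split: sum.split)

lemma hblock_mv: "hblock X Y *v vjoin p q = X *v p + Y *v q"
  by (simp add: hblock_def vjoin_def vec_eq_iff matrix_vector_mult_def sum_UNIV_Plus)

lemma sesq_diag_block: "sesq (diag_block X Y) (vjoin p q) = sesq X p + sesq Y q"
  by (simp add: sesq_def diag_block_def hblock_def vjoin_def matrix_vector_mult_def sum_UNIV_Plus)

lemma pos_def_diag_block:
  assumes "pos_def X" "pos_def Y"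
  shows "pos_def (diag_block X Y)"
  unfolding pos_def_def
proof (intro conjI allI impI)
  have "cnj (X $ i $ j) = X $ j $ i" "cnj (Y $ k $ l) = Y $ l $ k" for i j k l
    using assms[THEN pos_def_hermitian] by (simp_all add: vec_eq_iff transpose_def)
  then show "herm (diag_block X Y) = diag_block X Y"
    by (auto simp: vec_eq_iff transpose_def diag_block_def hblock_def split: sum.split)
  fix w :: "complex^('a + 'b)" assume w: "w \<noteq> 0"
  obtain p q where [simp]: "w = vjoin p q" by (rule vjoin_cases)
  show "0 < Re (sesq (diag_block X Y) w)"
    using w assms pos_def_ge_0[OF assms(1), of p] pos_def_ge_0[OF assms(2), of q]
    by (cases "p = 0"; cases "q = 0") (auto simp: sesq_diag_block vjoin_eq_0_iff pos_def_def
      intro: add_pos_nonneg add_nonneg_pos)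
qed

section \<open>The Riccati operator and its two-step form\<close>

lemma antilin_step_vcnj: "antilin_step A B x u = vcnj (A *v x + B *v u)"
  by (simp add: antilin_step_def vcnj_add vcnj_mv)

locale antilinear_lqr =
  fixes A :: "complex^'n^'n" and B :: "complex^'m^'n"
    and Q :: "complex^'n^'n" and R :: "complex^'m^'m"
  assumes Q: "pos_def Q" and R: "pos_def R"
begin

definition stage :: "complex^'n \<Rightarrow> complex^'m \<Rightarrow> complex" where
  "stage x u = sesq Q x + sesq R u"

text \<open>\<open>P\<close> enters conjugated because a step ends with a conjugation, and
  \<open>sesq P (vcnj y) = sesq (mcnj P) y\<close> for Hermitian \<open>P\<close>.\<close>

definition gain :: "complex^'n^'n \<Rightarrow> complex^'n^'m" where
  "gain P = lq_gain A B R (mcnj P)"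

definition riccati :: "complex^'n^'n \<Rightarrow> complex^'n^'n" where
  "riccati P = Q + lq_reduce A B R (mcnj P)"

definition two_step_riccati :: "complex^'n^'n \<Rightarrow> complex^'n^'n" where
  "two_step_riccati P = Q_N A B Q R + lq_reduce (A_N A B Q R) (B_N A B) (R_N B Q R) P"

lemma pos_def_S_mat: "pos_def P \<Longrightarrow> pos_def (S_mat B P R)"
  unfolding S_mat_def using R by (intro pos_def_lq_weight pos_def_mcnj)

lemma pos_def_riccati: "pos_def P \<Longrightarrow> pos_def (riccati P)"
  unfolding riccati_def using Q R
  by (intro pos_def_add lq_reduce_hermitian lq_reduce_nonneg pos_def_mcnj)

lemma riccati_ge: "pos_def P \<Longrightarrow> Re (sesq Q x) \<le> Re (sesq (riccati P) x)"
  unfolding riccati_def using R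
  by (simp add: sesq_add_mat lq_reduce_nonneg pos_def_mcnj)

lemma one_step:
  assumes P: "pos_def P"
  shows "stage x u + sesq P (antilin_step A B x u) =
    sesq (riccati P) x + sesq (S_mat B P R) (u + gain P *v x)"
  using complete_square[OF R pos_def_mcnj[OF P], of u A x B]
  by (simp add: stage_def antilin_step_vcnj sesq_vcnj[OF pos_def_hermitian[OF P]] riccati_def
      sesq_add_mat gain_def S_mat_def)

lemma riccati_le:
  assumes P: "pos_def P"
  shows "Re (sesq (riccati P) x) \<le> Re (stage x u + sesq P (antilin_step A B x u))"
  using pos_def_ge_0[OF pos_def_S_mat[OF P]] by (simp add: one_step[OF P])

text \<open>By the Woodbury identity, \<open>Q_N\<close> is \<open>riccati Q\<close>: it already
  contains the optimization of the first control against the weight \<open>Q\<close> of the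
  intermediate state.\<close>

lemma Q_N_lq_reduce: "Q_N A B Q R = Q + lq_reduce A B R (mcnj Q)"
proof -
  have "matrix_inv (mcnj (matrix_inv Q) + B ** matrix_inv R ** herm B)
    = mcnj Q - mcnj Q ** B ** matrix_inv (R + herm B ** mcnj Q ** B) ** herm B ** mcnj Q"
    using woodbury[of "mcnj Q" R B] Q R mcnj_matrix_inv[OF pos_def_invertible[OF Q]]
    by (simp add: pos_def_mcnj pos_def_invertible pos_def_lq_weight)
  then show ?thesis
    by (simp add: Q_N_def lq_reduce_def lq_gain_def matrix_diff_ldistrib matrix_diff_rdistrib
        matrix_mul_assoc)
qed

lemma pos_def_R_N: "pos_def (R_N B Q R)"
  unfolding R_N_def using R Q by (intro pos_def_diag_block pos_def_mcnj pos_def_S_mat)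

lemma two_step:
  assumes P: "pos_def P"
  shows "stage x u0 + stage (antilin_step A B x u0) u1
      + sesq P (antilin_step A B (antilin_step A B x u0) u1) =
    sesq (two_step_riccati P) x
      + sesq (R_N B Q R + herm (B_N A B) ** P ** B_N A B)
          (vjoin (vcnj u1) (u0 + gain Q *v x) + riccati_gain A B Q R P *v x)"
proof -
  define x1 where "x1 = antilin_step A B x u0"
  \<comment> \<open>The shift completes the square for the first stage together with the state cost
    of \<open>x1\<close>, so the remaining cost has no product of state and input.\<close>
  define v where "v = u0 + gain Q *v x"
  \<comment> \<open>The two-step state is linear in the first control and in the conjugate of the
    second; the order of the blocks follows \<open>B_N\<close>.\<close>
  define w where "w = vjoin (vcnj u1) v"
  have x2: "antilin_step A B x1 u1 = A_N A B Q R *v x + B_N A B *v w"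
  proof -
    have "A_N A B Q R = mcnj A ** (A - B ** gain Q)"
      by (simp add: A_N_def gain_def lq_gain_def S_mat_def matrix_diff_ldistrib
          matrix_diff_rdistrib matrix_mul_assoc)
    then have "A_N A B Q R *v x + B_N A B *v w =
      mcnj A *v (A *v x - B *v (gain Q *v x)) + mcnj B *v vcnj u1 + mcnj A *v (B *v v)"
      by (simp add: B_N_def w_def hblock_mv matrix_vector_mul_assoc[symmetric]
          matrix_vector_mult_diff_rdistrib)
    also have "\<dots> = mcnj A *v (A *v x + B *v u0) + mcnj B *v vcnj u1"
      by (simp add: v_def algebra_simps)
    finally show ?thesis
      unfolding x1_def antilin_step_vcnj[of A B x] by (simp add: antilin_step_def)
  qed
  have "stage x u0 + sesq Q x1 = sesq (Q_N A B Q R) x + sesq (S_mat B Q R) v"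
    using one_step[OF Q, of x u0] by (simp add: x1_def v_def riccati_def Q_N_lq_reduce)
  moreover have "sesq (R_N B Q R) w = sesq R u1 + sesq (S_mat B Q R) v"
    by (simp add: R_N_def w_def sesq_diag_block sesq_mcnj[of R] sesq_hermitian_real[OF pos_def_hermitian[OF R]])
  moreover note complete_square[OF pos_def_R_N P, of w "A_N A B Q R" x "B_N A B"]
  moreover have "riccati_gain A B Q R P = lq_gain (A_N A B Q R) (B_N A B) (R_N B Q R) P"
    by (simp add: riccati_gain_def lq_gain_def)
  ultimately show ?thesis
    unfolding x1_def[symmetric] v_def[symmetric] w_def[symmetric] x2
    by (simp add: stage_def[of x1] two_step_riccati_def sesq_add_mat[of "Q_N A B Q R"] algebra_simps)
qed

lemma normal_riccati_iff: "normal_riccati A B Q R P \<longleftrightarrow> two_step_riccati P = P"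
proof -
  have "normal_riccati A B Q R P \<longleftrightarrow>
      - Q_N A B Q R = lq_reduce (A_N A B Q R) (B_N A B) (R_N B Q R) P - P"
    by (simp add: normal_riccati_def lq_reduce_def lq_gain_def riccati_gain_def algebra_simps
        matrix_mul_assoc)
  then show ?thesis
    by (auto simp: two_step_riccati_def algebra_simps)
qed

end

section \<open>Optimal control\<close>

text \<open>The closed-loop states are generated first and the control is read off, which breaks the
  mutual dependence of state and control. A time-dependent law allows alternating gains.\<close>

lemma feedback_control_exists: "\<exists>u. \<forall>k. u k = F k (traj A B x0 u k)"
proof -
  define x where "x = rec_nat x0 (\<lambda>k y. antilin_step A B y (F k y))"
  have "traj A B x0 (\<lambda>k. F k (x k)) k = x k" for k
    by (induction k) (simp_all add: x_def)
  then show ?thesis by (intro exI[of _ "\<lambda>k. F k (x k)"]) simp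
qed

context antilinear_lqr
begin

lemma pos_def_two_step_riccati: "pos_def P \<Longrightarrow> pos_def (two_step_riccati P)"
  using pos_def_riccati[OF Q] pos_def_R_N
  by (auto simp: two_step_riccati_def Q_N_lq_reduce riccati_def
      intro!: pos_def_add[of "Q + _"] lq_reduce_hermitian lq_reduce_nonneg)

lemma two_step_dp:
  assumes P: "pos_def P"
  shows "stage x u0 + stage (antilin_step A B x u0) u1
      + sesq P (antilin_step A B (antilin_step A B x u0) u1) =
    sesq (riccati (riccati P)) x + sesq (S_mat B (riccati P) R) (u0 + gain (riccati P) *v x)
      + sesq (S_mat B P R) (u1 + gain P *v antilin_step A B x u0)"
  using one_step[OF pos_def_riccati[OF P], of x u0] one_step[OF P, of "antilin_step A B x u0" u1]
  by (simp add: algebra_simps)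

text \<open>Both sides are the minimal cost of two steps followed by the terminal cost \<open>P\<close>: the left
  one by minimizing over both controls simultaneously, the right one by dynamic programming. The
  two minimizing controls agree as well.\<close>

lemma
  assumes P: "pos_def P"
  shows two_step_riccati_eq: "two_step_riccati P = riccati (riccati P)"
    and K1_opt_gain: "K1_opt A B Q R P *v x = - (gain (riccati P) *v x)"
proof -
  let ?SN = "R_N B Q R + herm (B_N A B) ** P ** B_N A B"
  have SN: "pos_def ?SN" using pos_def_R_N P by (rule pos_def_lq_weight)
  have S1: "pos_def (S_mat B (riccati P) R)" and S2: "pos_def (S_mat B P R)"
    using P by (simp_all add: pos_def_S_mat pos_def_riccati)
  have le: "Re (sesq (two_step_riccati P) x) \<le> Re (sesq (riccati (riccati P)) x)" for x
  proof -
    \<comment> \<open>The controls of dynamic programming annihilate both squares on that side,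
      while the two-step square stays nonnegative.\<close>
    define u0 where "u0 = - (gain (riccati P) *v x)"
    define u1 where "u1 = - (gain P *v antilin_step A B x u0)"
    show ?thesis
      using two_step[OF P, of x u0 u1] two_step_dp[OF P, of x u0 u1] pos_def_ge_0[OF SN]
      by (simp add: u0_def[symmetric] u1_def[symmetric]) (simp add: u0_def u1_def)
  qed
  have opt: "Re (sesq (two_step_riccati P) x) = Re (sesq (riccati (riccati P)) x) \<and>
      K1_opt A B Q R P *v x = - (gain (riccati P) *v x)" for x
  proof -
    obtain p q where pq: "- (riccati_gain A B Q R P *v x) = vjoin p q" by (rule vjoin_cases)
    \<comment> \<open>Read the controls off the joint minimizer: \<open>q\<close> is the shifted
      first control, \<open>p\<close> the conjugated second one.\<close>
    define u0 where "u0 = q - gain Q *v x"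
    define u1 where "u1 = vcnj p"
    have "(hblock 0 (mat 1) :: complex^('m + 'm)^'m) *v (riccati_gain A B Q R P *v x) = - q"
      using arg_cong[OF pq, of "\<lambda>w. (hblock 0 (mat 1) :: complex^('m + 'm)^'m) *v w"]
      by (simp add: hblock_mv minus_equation_iff[of _ q] vec.neg)
    then have K: "K1_opt A B Q R P *v x = u0"
      unfolding K1_opt_def minus_mv matrix_vector_mult_add_rdistrib
      by (simp add: u0_def matrix_vector_mul_assoc[symmetric] gain_def lq_gain_def S_mat_def)
    have "vjoin (vcnj u1) (u0 + gain Q *v x) + riccati_gain A B Q R P *v x = 0"
      using pq by (simp add: u0_def u1_def) (metis add.left_inverse)
    then have "Re (sesq (two_step_riccati P) x) = Re (sesq (riccati (riccati P)) x)
        + Re (sesq (S_mat B (riccati P) R) (u0 + gain (riccati P) *v x))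
        + Re (sesq (S_mat B P R) (u1 + gain P *v antilin_step A B x u0))"
      using two_step[OF P, of x u0 u1] two_step_dp[OF P, of x u0 u1]
      by (simp only: sesq_0 add_0_right plus_complex.sel(1)[symmetric])
    moreover note le[of x] pos_def_ge_0[OF S1, of "u0 + gain (riccati P) *v x"]
      pos_def_ge_0[OF S2, of "u1 + gain P *v antilin_step A B x u0"]
    \<comment> \<open>Together with \<open>le\<close> this forces both squares of dynamic
      programming to be zero; the first one identifies the first control.\<close>
    ultimately have "Re (sesq (two_step_riccati P) x) = Re (sesq (riccati (riccati P)) x)"
      and "Re (sesq (S_mat B (riccati P) R) (u0 + gain (riccati P) *v x)) = 0"
      by linarith+
    then show ?thesis
      using K pos_def_eq_0_iff[OF S1] by (simp add: add_eq_0_iff)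
  qed
  show "two_step_riccati P = riccati (riccati P)"
    by (rule hermitian_eqI)
      (simp_all add: opt P pos_def_hermitian pos_def_two_step_riccati pos_def_riccati)
  show "K1_opt A B Q R P *v x = - (gain (riccati P) *v x)"
    using opt by blast
qed

lemma normal_riccati_iff_two_step:
  "pos_def P \<Longrightarrow> normal_riccati A B Q R P \<longleftrightarrow> riccati (riccati P) = P"
  by (simp add: normal_riccati_iff two_step_riccati_eq)

lemma stage_nonneg: "0 \<le> Re (stage x u)"
  using Q R by (simp add: stage_def pos_def_ge_0)

lemma stage_ge: "Re (sesq Q x) \<le> Re (stage x u)"
  using R by (simp add: stage_def pos_def_ge_0)

text \<open>Sum of the one-step identities, with weights running backwards under
  \<open>riccati\<close>. Weights that vary in time serve both the alternating costs-to-go and the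
  finite-horizon iterates.\<close>

lemma cost_telescope:
  assumes "\<And>k. k \<le> N \<Longrightarrow> pos_def (P k)" "\<And>k. k < N \<Longrightarrow> P k = riccati (P (Suc k))"
  shows "(\<Sum>k<N. stage (traj A B x0 u k) (u k)) + sesq (P N) (traj A B x0 u N) =
    sesq (P 0) x0 + (\<Sum>k<N. sesq (S_mat B (P (Suc k)) R) (u k + gain (P (Suc k)) *v traj A B x0 u k))"
  using assms
proof (induction N)
  case (Suc N)
  have "riccati (P (Suc N)) = P N" "pos_def (P (Suc N))" using Suc.prems by simp_all
  then have "stage (traj A B x0 u N) (u N) + sesq (P (Suc N)) (traj A B x0 u (Suc N)) =
      sesq (P N) (traj A B x0 u N)
      + sesq (S_mat B (P (Suc N)) R) (u N + gain (P (Suc N)) *v traj A B x0 u N)"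
    using one_step[of "P (Suc N)" "traj A B x0 u N" "u N"] by simp
  moreover have "(\<Sum>k<N. stage (traj A B x0 u k) (u k)) + sesq (P N) (traj A B x0 u N) =
      sesq (P 0) x0
      + (\<Sum>k<N. sesq (S_mat B (P (Suc k)) R) (u k + gain (P (Suc k)) *v traj A B x0 u k))"
    by (rule Suc.IH; rule Suc.prems) simp_all
  ultimately show ?case
    unfolding sum.lessThan_Suc by algebra
qed simp

section \<open>The cost as a series of stages\<close>

abbreviation cost :: "complex^'n \<Rightarrow> (nat \<Rightarrow> complex^'m) \<Rightarrow> ennreal" where
  "cost \<equiv> lqr_cost A B Q R"

abbreviation stages :: "complex^'n \<Rightarrow> (nat \<Rightarrow> complex^'m) \<Rightarrow> nat \<Rightarrow> real" where
  "stages x0 u k \<equiv> Re (stage (traj A B x0 u k) (u k))"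

lemma cost_stages: "cost x0 u = (\<Sum>k. ennreal (stages x0 u k))"
  by (simp add: lqr_cost_def stage_def)

lemma cost_summable: "summable (stages x0 u) \<Longrightarrow> cost x0 u = ennreal (suminf (stages x0 u))"
  unfolding cost_stages by (intro suminf_ennreal2 stage_nonneg)

lemma cost_finite_iff: "cost x0 u < top \<longleftrightarrow> summable (stages x0 u)"
proof
  assume "cost x0 u < top"
  then show "summable (stages x0 u)"
    unfolding cost_stages by (intro summable_suminf_not_top stage_nonneg) auto
qed (simp add: cost_summable)

text \<open>Since \<open>Q\<close> is positive definite, each stage dominates a multiple of the
  squared norm of the state.\<close>

lemma stages_tendsto_0:
  assumes "summable (stages x0 u)"
  shows "traj A B x0 u \<longlonglongrightarrow> 0"
proof -
  obtain q where q: "q > 0" "\<And>x. q * (norm x)\<^sup>2 \<le> Re (sesq Q x)"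
    using pos_def_lower_bound[OF Q] by metis
  have "(\<lambda>k. (norm (traj A B x0 u k))\<^sup>2) \<longlonglongrightarrow> 0"
  proof (rule tendsto_sandwich[OF _ _ tendsto_const])
    show "(\<lambda>k. stages x0 u k / q) \<longlonglongrightarrow> 0"
      using tendsto_divide[OF summable_LIMSEQ_zero[OF assms] tendsto_const, of q] q by simp
    show "\<forall>\<^sub>F k in sequentially. (norm (traj A B x0 u k))\<^sup>2 \<le> stages x0 u k / q"
      using q order_trans[OF q(2) stage_ge] by (simp add: field_simps)
  qed simp
  then show ?thesis
    by (simp add: tendsto_norm_zero_iff power_tendsto_0_iff)
qed

lemma tendsto_sesq_zero:
  assumes "x \<longlonglongrightarrow> (0 :: complex^'n)"
  shows "(\<lambda>k. Re (sesq M (x k))) \<longlonglongrightarrow> 0"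
proof (rule Lim_null_comparison)
  show "\<forall>\<^sub>F k in sequentially. norm (Re (sesq M (x k)))
      \<le> (\<Sum>i\<in>UNIV. \<Sum>j\<in>UNIV. cmod (M $ i $ j)) * (norm (x k))\<^sup>2"
    by (intro always_eventually allI) (simp add: order_trans[OF abs_Re_le_cmod sesq_norm_le])
  show "(\<lambda>k. (\<Sum>i\<in>UNIV. \<Sum>j\<in>UNIV. cmod (M $ i $ j)) * (norm (x k))\<^sup>2) \<longlonglongrightarrow> 0"
    using tendsto_mult[OF tendsto_const tendsto_power[OF tendsto_norm_zero[OF assms], of 2]] by simp
qed

text \<open>A solution of the normal equation is a priori only a fixed point of the twofold Riccati map, so
  the cost-to-go alternates between \<open>P\<close> and \<open>riccati P\<close>.\<close>

definition alternating :: "complex^'n^'n \<Rightarrow> nat \<Rightarrow> complex^'n^'n" where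
  "alternating P k = (if even k then P else riccati P)"

text \<open>The loss at time \<open>k\<close> against the feedback. The weight is that of time
  \<open>Suc k\<close>, because the control acts on the next state.\<close>

definition excess :: "complex^'n^'n \<Rightarrow> complex^'n \<Rightarrow> (nat \<Rightarrow> complex^'m) \<Rightarrow> nat \<Rightarrow> real" where
  "excess P x0 u k = Re (sesq (S_mat B (alternating P (Suc k)) R)
     (u k + gain (alternating P (Suc k)) *v traj A B x0 u k))"

section \<open>Costs measured against a fixed point of the twofold Riccati map\<close>

context
  fixes P
  assumes P: "pos_def P" and fix2: "riccati (riccati P) = P"
begin

lemma alternating_fixpoint: "riccati P = P \<Longrightarrow> alternating P k = P"
  by (simp add: alternating_def)

lemma pos_def_alternating: "pos_def (alternating P k)"
  using P by (simp add: alternating_def pos_def_riccati)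

lemma excess_nonneg: "0 \<le> excess P x0 u k"
  unfolding excess_def by (intro pos_def_ge_0 pos_def_S_mat pos_def_alternating)

lemma excess_eq_0_iff:
  "excess P x0 u k = 0 \<longleftrightarrow> u k = - (gain (alternating P (Suc k)) *v traj A B x0 u k)"
  unfolding excess_def
  by (subst pos_def_eq_0_iff) (auto intro: pos_def_S_mat pos_def_alternating simp: add_eq_0_iff2)

lemma sum_stages_excess:
  "(\<Sum>k<N. stages x0 u k) + Re (sesq (alternating P N) (traj A B x0 u N)) =
    Re (sesq P x0) + (\<Sum>k<N. excess P x0 u k)"
  using arg_cong[OF cost_telescope[of N "alternating P" x0 u], of Re] pos_def_alternating fix2
  by (auto simp: excess_def alternating_def)

text \<open>Finite cost drives the state to \<open>0\<close>, which removes the terminal term; the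
  two alternating weights are bounded together.\<close>

lemma excess_sums:
  assumes s: "summable (stages x0 u)"
  shows "excess P x0 u sums (suminf (stages x0 u) - Re (sesq P x0))"
proof -
  have "(\<lambda>N. Re (sesq (alternating P N) (traj A B x0 u N))) \<longlonglongrightarrow> 0"
  proof (rule Lim_null_comparison)
    show "\<forall>\<^sub>F N in sequentially. norm (Re (sesq (alternating P N) (traj A B x0 u N))) \<le>
        \<bar>Re (sesq P (traj A B x0 u N))\<bar> + \<bar>Re (sesq (riccati P) (traj A B x0 u N))\<bar>"
      by (simp add: alternating_def)
    show "(\<lambda>N. \<bar>Re (sesq P (traj A B x0 u N))\<bar> + \<bar>Re (sesq (riccati P) (traj A B x0 u N))\<bar>) \<longlonglongrightarrow> 0"
      by (intro tendsto_add_zero tendsto_rabs_zero tendsto_sesq_zero stages_tendsto_0 s)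
  qed
  with summable_LIMSEQ[OF s]
  have "(\<lambda>N. (\<Sum>k<N. stages x0 u k) + Re (sesq (alternating P N) (traj A B x0 u N)) - Re (sesq P x0))
      \<longlonglongrightarrow> suminf (stages x0 u) + 0 - Re (sesq P x0)"
    by (intro tendsto_intros)
  then show ?thesis
    by (simp add: sum_stages_excess sums_def)
qed

lemma cost_ge: "ennreal (Re (sesq P x0)) \<le> cost x0 u"
proof (cases "summable (stages x0 u)")
  case True
  have "0 \<le> suminf (stages x0 u) - Re (sesq P x0)"
    using excess_sums[OF True] excess_nonneg
    by (metis sums_iff suminf_nonneg)
  then show ?thesis by (simp add: cost_summable[OF True] ennreal_leI)
next
  case False
  then have "cost x0 u = top" using cost_finite_iff top.not_eq_extremum by blast
  then show ?thesis by simp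
qed

text \<open>Finiteness has to come first: with no excess the partial sums are at most the value of
  \<open>P\<close>, because the terminal term is nonnegative.\<close>

lemma cost_of_zero_excess:
  assumes "\<And>k. excess P x0 u k = 0"
  shows "cost x0 u = ennreal (Re (sesq P x0))"
proof -
  have b: "(\<Sum>k<N. stages x0 u k) \<le> Re (sesq P x0)" for N
    using sum_stages_excess[where N = N and u = u and ?x0.0 = x0] assms
      pos_def_ge_0[OF pos_def_alternating[of N]]
    by (simp add: add_le_cancel_left) (metis le_add_same_cancel1)
  have s: "summable (stages x0 u)"
    using b stage_nonneg by (intro bounded_imp_summable[where B = "Re (sesq P x0)"])
      (auto simp: lessThan_Suc_atMost[symmetric] simp del: sum.lessThan_Suc)
  then have "suminf (stages x0 u) \<le> Re (sesq P x0)"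
    using b by (intro suminf_le_const) auto
  then have "cost x0 u \<le> ennreal (Re (sesq P x0))"
    by (simp add: cost_summable[OF s] ennreal_leI)
  with cost_ge show ?thesis by (rule antisym[rotated])
qed

lemma zero_excess_exists: "\<exists>u. \<forall>k. excess P x0 u k = 0"
  unfolding excess_eq_0_iff by (rule feedback_control_exists)

lemma optimal_exists: "\<exists>u. lqr_optimal A B Q R x0 u \<and> cost x0 u = ennreal (Re (sesq P x0))"
  using zero_excess_exists cost_of_zero_excess cost_ge unfolding lqr_optimal_def by metis

text \<open>An optimal control costs no more than the feedback, so its excess has sum at most
  \<open>0\<close>; the terms are nonnegative and must vanish.\<close>

lemma optimal_iff_zero_excess: "lqr_optimal A B Q R x0 u \<longleftrightarrow> (\<forall>k. excess P x0 u k = 0)"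
proof
  assume "\<forall>k. excess P x0 u k = 0"
  then show "lqr_optimal A B Q R x0 u"
    using cost_of_zero_excess cost_ge by (simp add: lqr_optimal_def)
next
  assume "lqr_optimal A B Q R x0 u"
  then have le: "cost x0 u \<le> ennreal (Re (sesq P x0))"
    using optimal_exists[of x0] unfolding lqr_optimal_def by metis
  then have s: "summable (stages x0 u)"
    using cost_finite_iff le_less_trans[OF le ennreal_less_top] by blast
  then have "suminf (stages x0 u) \<le> Re (sesq P x0)"
    using le pos_def_ge_0[OF P] by (simp add: cost_summable)
  then have "suminf (excess P x0 u) \<le> 0" "summable (excess P x0 u)"
    using excess_sums[OF s] by (auto simp: sums_iff)
  then show "\<forall>k. excess P x0 u k = 0"
    using excess_nonneg suminf_eq_zero_iff[of "excess P x0 u"] suminf_nonneg[of "excess P x0 u"]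
    by force
qed

lemma optimal_cost: "lqr_optimal A B Q R x0 u \<Longrightarrow> cost x0 u = ennreal (Re (sesq P x0))"
  by (simp add: optimal_iff_zero_excess cost_of_zero_excess)

end

text \<open>Both forms equal the optimal cost from every initial state, which depends on neither
  solution.\<close>

lemma two_step_solution_unique:
  assumes "pos_def P" "riccati (riccati P) = P" "pos_def P'" "riccati (riccati P') = P'"
  shows "P = P'"
proof (rule hermitian_eqI)
  fix x
  obtain u where "lqr_optimal A B Q R x u" using optimal_exists[OF assms(1,2)] by blast
  then have "ennreal (Re (sesq P x)) = ennreal (Re (sesq P' x))"
    using optimal_cost assms by metis
  then show "Re (sesq P x) = Re (sesq P' x)"
    using assms by (simp add: pos_def_ge_0)
qed (use assms in \<open>simp_all add: pos_def_hermitian\<close>)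

text \<open>\<open>riccati P\<close> solves the two-step equation as well, so uniqueness identifies
  it with \<open>P\<close>.\<close>

lemma two_step_solution_fixpoint:
  assumes "pos_def P" "riccati (riccati P) = P"
  shows "riccati P = P"
  using two_step_solution_unique[of "riccati P" P] assms by (simp add: pos_def_riccati)

lemma normal_riccati_iff_fixpoint:
  assumes P: "pos_def P"
  shows "normal_riccati A B Q R P \<longleftrightarrow> riccati P = P"
  unfolding normal_riccati_iff_two_step[OF P]
proof
  show "riccati P = P" if "riccati (riccati P) = P"
    using P that by (rule two_step_solution_fixpoint)
qed simp

lemma optimal_iff_feedback:
  assumes P: "pos_def P" and fix1: "riccati P = P"
  shows "lqr_optimal A B Q R x0 u \<longleftrightarrow> (\<forall>k. u k = K1_opt A B Q R P *v traj A B x0 u k)"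
  using assms by (simp add: optimal_iff_zero_excess excess_eq_0_iff K1_opt_gain alternating_fixpoint)

section \<open>Stability of the optimal feedback\<close>

lemma closed_loop_traj:
  assumes "\<And>k. u k = F (traj A B x0 u k)"
  shows "(closed_loop A B F ^^ k) x0 = traj A B x0 u k"
  by (induction k) (simp_all add: closed_loop_def assms[symmetric])

text \<open>Every stage is at most the total cost: \<open>q\<close> bounds a stage below and
  \<open>p\<close> bounds the cost above by squared norms. The resulting uniform bound gives
  Lyapunov stability; finite cost gives attraction.\<close>

lemma closed_loop_stable:
  assumes P: "pos_def P" and fix1: "riccati P = P"
  shows "asymptotically_stable (closed_loop A B (\<lambda>x. K1_opt A B Q R P *v x))"
    (is "asymptotically_stable ?f")
proof -
  have fix2: "riccati (riccati P) = P" by (simp add: fix1)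
  obtain q where q: "q > 0" "\<And>x. q * (norm x)\<^sup>2 \<le> Re (sesq Q x)"
    using pos_def_lower_bound[OF Q] by metis
  define p where "p = (\<Sum>i\<in>UNIV. \<Sum>j\<in>UNIV. cmod (P $ i $ j)) + 1"
  have p: "Re (sesq P x) \<le> p * (norm x)\<^sup>2" for x
    using order_trans[OF complex_Re_le_cmod sesq_norm_le[of P x]]
    by (simp add: p_def distrib_right add_increasing2)
  have p0: "p > 0"
    by (simp add: p_def add_nonneg_pos sum_nonneg)
  have loop: "(\<lambda>k. (?f ^^ k) x0) \<longlonglongrightarrow> 0 \<and> (\<forall>k. norm ((?f ^^ k) x0) \<le> sqrt (p / q) * norm x0)" for x0
  proof -
    obtain u where u: "\<And>k. u k = K1_opt A B Q R P *v traj A B x0 u k"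
      using feedback_control_exists[of "\<lambda>k x. K1_opt A B Q R P *v x" A B x0] by blast
    then have "cost x0 u = ennreal (Re (sesq P x0))"
      using optimal_iff_feedback[OF P fix1, of x0 u] optimal_cost[OF P fix2, of x0 u] by simp
    then have s: "summable (stages x0 u)" and "suminf (stages x0 u) \<le> Re (sesq P x0)"
      using cost_finite_iff[of x0 u] cost_summable[of x0 u] pos_def_ge_0[OF P, of x0]
      by (auto simp: suminf_nonneg stage_nonneg)
    then have "stages x0 u k \<le> Re (sesq P x0)" for k
      using sum_le_suminf[OF s, of "{k}"] stage_nonneg by simp
    then have "q * (norm (traj A B x0 u k))\<^sup>2 \<le> p * (norm x0)\<^sup>2" for k
      by (rule order_trans[OF q(2) order_trans[OF stage_ge order_trans[OF _ p]]])
    then have "(norm (traj A B x0 u k))\<^sup>2 \<le> (sqrt (p / q) * norm x0)\<^sup>2" for k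
      using p0 q(1) by (simp add: power_mult_distrib pos_le_divide_eq mult.commute)
    then have "norm (traj A B x0 u k) \<le> sqrt (p / q) * norm x0" for k
      by (rule power2_le_imp_le) (use p0 q(1) in simp)
    moreover have "(?f ^^ k) x0 = traj A B x0 u k" for k
      using u by (rule closed_loop_traj)
    ultimately show ?thesis using stages_tendsto_0[OF s] by simp
  qed
  show ?thesis
    unfolding asymptotically_stable_def
  proof (intro conjI allI impI)
    show "(\<lambda>k. (?f ^^ k) x0) \<longlonglongrightarrow> 0" for x0
      using loop by (rule conjunct1)
    fix e :: real assume "e > 0"
    show "\<exists>d>0. \<forall>x0. norm x0 < d \<longrightarrow> (\<forall>k. norm ((?f ^^ k) x0) < e)"
    proof (rule exI[of _ "e / sqrt (p / q)"], intro conjI allI impI)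
      show "e / sqrt (p / q) > 0" using \<open>e > 0\<close> p0 q(1) by simp
      fix x0 k assume "norm (x0 :: complex^'n) < e / sqrt (p / q)"
      then have "sqrt (p / q) * norm x0 < e"
        using p0 q(1) by (simp add: pos_less_divide_eq mult.commute)
      then show "norm ((?f ^^ k) x0) < e"
        by (rule le_less_trans[OF conjunct2[OF loop, rule_format]])
    qed
  qed
qed

text \<open>Apply the control that is optimal for the larger weight \<open>P'\<close> under both
  weights.\<close>

lemma riccati_mono:
  assumes P: "pos_def P" and P': "pos_def P'" and le: "\<And>x. Re (sesq P x) \<le> Re (sesq P' x)"
  shows "Re (sesq (riccati P) x) \<le> Re (sesq (riccati P') x)"
proof -
  define u where "u = - (gain P' *v x)"
  have "Re (sesq (riccati P) x) \<le> Re (stage x u + sesq P (antilin_step A B x u))"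
    using P by (rule riccati_le)
  also have "\<dots> \<le> Re (stage x u + sesq P' (antilin_step A B x u))"
    by (simp add: le)
  also have "\<dots> = Re (sesq (riccati P') x)"
    by (simp add: one_step[OF P'] u_def)
  finally show ?thesis .
qed

text \<open>Value iteration from \<open>Q\<close>: the iterates are optimal finite-horizon costs
  with terminal weight \<open>Q\<close>. They increase and are bounded by the cost of any
  finite-cost control, so they converge.\<close>

lemma riccati_fixpoint_exists:
  assumes finite_cost: "\<And>x0. \<exists>u. cost x0 u < top"
  obtains P where "pos_def P" "riccati P = P"
proof -
  define M where "M k = (riccati ^^ k) Q" for k
  have M_Suc: "riccati (M k) = M (Suc k)" for k by (simp add: M_def)
  have M: "pos_def (M k)" for k
    by (induction k) (simp_all add: M_def Q pos_def_riccati)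
  have M_step: "Re (sesq (M k) x) \<le> Re (sesq (M (Suc k)) x)" for k x
  proof (induction k arbitrary: x)
    case 0
    show ?case using riccati_ge[OF Q] by (simp add: M_def)
  next
    case (Suc k)
    then show ?case unfolding M_Suc[symmetric] using M by (intro riccati_mono) (simp_all add: M_Suc)
  qed
  have mono: "incseq (\<lambda>k. Re (sesq (M k) x))" for x
    by (intro incseq_SucI M_step)
  have "convergent (\<lambda>k. Re (sesq (M k) x))" for x
  proof -
    obtain u where "summable (stages x u)" using finite_cost[of x] by (auto simp: cost_finite_iff)
    have "Re (sesq (M N) x) \<le> suminf (stages x u)" for N
    proof -
      have "Re (sesq (M N) x) \<le> (\<Sum>k<N. stages x u k) + Re (sesq Q (traj A B x u N))"
      proof -
        \<comment> \<open>Reversed time: at time \<open>k\<close> there are \<open>N - k\<close>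
          steps to go.\<close>
        define P where "P k = M (N - k)" for k
        have "P k = riccati (P (Suc k))" if "k < N" for k
          using that by (simp add: P_def M_Suc Suc_diff_Suc)
        then have "(\<Sum>k<N. stage (traj A B x u k) (u k)) + sesq (P N) (traj A B x u N) =
          sesq (P 0) x + (\<Sum>k<N. sesq (S_mat B (P (Suc k)) R) (u k + gain (P (Suc k)) *v traj A B x u k))"
          by (intro cost_telescope) (simp_all add: P_def M)
        from arg_cong[OF this, of Re] show ?thesis
          by (simp add: P_def M_def[of 0] sum_nonneg pos_def_ge_0 pos_def_S_mat M)
      qed
      \<comment> \<open>The terminal weight is \<open>Q\<close>, so the terminal term is at most one
        further stage.\<close>
      also have "\<dots> \<le> (\<Sum>k<Suc N. stages x u k)"
        by (simp add: stage_ge)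
      also have "\<dots> \<le> suminf (stages x u)"
        using \<open>summable (stages x u)\<close> stage_nonneg by (intro sum_le_suminf) auto
      finally show ?thesis .
    qed
    then have "\<forall>N. Re (sesq (M N) x) \<le> suminf (stages x u)" by blast
    then obtain l where "(\<lambda>k. Re (sesq (M k) x)) \<longlonglongrightarrow> l"
      by (rule incseq_convergent[OF mono])
    then show ?thesis by (rule convergentI)
  qed
  then obtain L where L: "M \<longlonglongrightarrow> L"
    using convergent_hermitian[of M] pos_def_hermitian[OF M] by blast
  have lim: "(\<lambda>k. Re (sesq (M k) x)) \<longlonglongrightarrow> Re (sesq L x)" for x
    using L by (intro tendsto_Re tendsto_sesq)
  have M_le_L: "Re (sesq (M k) x) \<le> Re (sesq L x)" for k x
    using mono lim by (rule incseq_le)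
  have "herm L = L"
  proof -
    have "(\<lambda>k. M k $ i $ j) \<longlonglongrightarrow> L $ i $ j" for i j
      by (intro tendsto_vec_nth L)
    moreover have "cnj (M k $ j $ i) = M k $ i $ j" for k i j
      using pos_def_hermitian[OF M, of k] by (auto simp: vec_eq_iff transpose_def)
    ultimately have "cnj (L $ j $ i) = L $ i $ j" for i j
      using LIMSEQ_unique[of "\<lambda>k. M k $ i $ j" "cnj (L $ j $ i)" "L $ i $ j"]
        tendsto_cnj[of "\<lambda>k. M k $ j $ i" "L $ j $ i" sequentially] by simp
    then show ?thesis by (simp add: vec_eq_iff transpose_def)
  qed
  moreover have "0 < Re (sesq L x)" if "x \<noteq> 0" for x
    using M_le_L[of 0 x] Q that by (auto simp: M_def pos_def_def intro: less_le_trans)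
  ultimately have posL: "pos_def L" by (simp add: pos_def_def)
  have eq: "Re (sesq (riccati L) x) = Re (sesq L x)" for x
  proof (rule antisym)
    show "Re (sesq L x) \<le> Re (sesq (riccati L) x)"
    proof (rule LIMSEQ_le_const2[OF LIMSEQ_Suc[OF lim]])
      show "\<exists>N. \<forall>n\<ge>N. Re (sesq (M (Suc n)) x) \<le> Re (sesq (riccati L) x)"
        unfolding M_Suc[symmetric] using riccati_mono[OF M posL M_le_L] by blast
    qed
    obtain q where q: "q > 0" "\<And>x. q * (norm x)\<^sup>2 \<le> Re (sesq Q x)"
      using pos_def_lower_bound[OF Q] by metis
    \<comment> \<open>To pass to the limit, use the minimizers for \<open>M k\<close>. The states
      \<open>y k\<close> they lead to stay bounded since \<open>M k\<close> dominates
      \<open>Q\<close>, so exchanging \<open>M k\<close> for \<open>L\<close> costs an error that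
      tends to zero.\<close>
    define u where "u k = - (gain (M k) *v x)" for k
    define y where "y k = antilin_step A B x (u k)" for k
    have dp: "Re (stage x (u k)) + Re (sesq (M k) (y k)) = Re (sesq (M (Suc k)) x)" for k
      using arg_cong[OF one_step[OF M, of x "u k" k], of Re] by (simp add: u_def y_def M_Suc)
    have "q * (norm (y k))\<^sup>2 \<le> Re (sesq L x)" for k
    proof -
      have "q * (norm (y k))\<^sup>2 \<le> Re (sesq (M 0) (y k))" using q by (simp add: M_def)
      also have "\<dots> \<le> Re (sesq (M k) (y k))" using incseqD[OF mono, of 0 k "y k"] by simp
      also have "\<dots> \<le> Re (sesq (M (Suc k)) x)" using dp[of k] stage_nonneg[of x "u k"] by linarith
      finally show ?thesis using M_le_L order_trans by blast
    qed
    then have y: "(norm (y k))\<^sup>2 \<le> Re (sesq L x) / q" for k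
      using q(1) by (simp add: field_simps)
    define D where "D k = (\<Sum>i\<in>UNIV. \<Sum>j\<in>UNIV. cmod ((L - M k) $ i $ j))" for k
    have "D \<longlonglongrightarrow> (\<Sum>i\<in>(UNIV :: 'n set). \<Sum>j\<in>(UNIV :: 'n set). cmod ((L - L) $ i $ j))"
      unfolding D_def by (intro tendsto_intros L)
    then have D: "D \<longlonglongrightarrow> 0" by simp
    have "Re (sesq (riccati L) x) \<le> Re (sesq (M (Suc k)) x) + D k * (Re (sesq L x) / q)" for k
    proof -
      have "Re (sesq (riccati L) x) \<le> Re (stage x (u k)) + Re (sesq L (y k))"
        using riccati_le[OF posL, of x "u k"] by (simp add: y_def)
      also have "\<dots> = Re (sesq (M (Suc k)) x) + Re (sesq (L - M k) (y k))"
        using dp[of k] by (simp add: sesq_diff_mat)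
      also have "Re (sesq (L - M k) (y k)) \<le> D k * (norm (y k))\<^sup>2"
        unfolding D_def by (rule order_trans[OF complex_Re_le_cmod sesq_norm_le])
      also have "\<dots> \<le> D k * (Re (sesq L x) / q)"
        by (intro mult_left_mono y) (simp add: D_def sum_nonneg)
      finally show ?thesis by simp
    qed
    moreover have "(\<lambda>k. Re (sesq (M (Suc k)) x) + D k * (Re (sesq L x) / q))
        \<longlonglongrightarrow> Re (sesq L x) + 0 * (Re (sesq L x) / q)"
      by (intro tendsto_intros LIMSEQ_Suc[OF lim] D)
    ultimately show "Re (sesq (riccati L) x) \<le> Re (sesq L x)"
      by (intro LIMSEQ_le_const) auto
  qed
  have "riccati L = L"
    by (rule hermitian_eqI) (simp_all add: eq posL pos_def_hermitian pos_def_riccati)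
  with posL show ?thesis by (rule that)
qed

end

section \<open>The rank condition is necessary\<close>

text \<open>\<open>rank\<close> is the dimension of the set of rows, whereas the right side concerns
  the indexed family; hence both directions also establish that the rows are distinct.\<close>

lemma rank_eq_rows_iff:
  fixes M :: "'a::field^'m^'n"
  shows "rank M = CARD('n) \<longleftrightarrow> (\<forall>c. (\<Sum>i\<in>UNIV. c i *s row i M) = 0 \<longrightarrow> (\<forall>i. c i = 0))"
proof
  assume r: "rank M = CARD('n)"
  have rows: "rows M = range (\<lambda>i. row i M)" by (auto simp: rows_def)
  have "card (rows M) \<le> CARD('n)" unfolding rows by (rule card_image_le) simp
  moreover have "vec.dim (rows M) \<le> card (rows M)" by (rule vec.dim_le_card') (simp add: rows)
  ultimately have c: "card (rows M) = CARD('n)" using r by (simp add: row_rank_def_gen)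
  then have inj: "inj (\<lambda>i. row i M)" unfolding rows by (intro eq_card_imp_inj_on) simp_all
  have ind: "vec.independent (rows M)"
    by (rule vec.card_le_dim_spanning[of _ "rows M"])
      (use r c in \<open>simp_all add: row_rank_def_gen vec.span_superset rows\<close>)
  show "\<forall>c. (\<Sum>i\<in>UNIV. c i *s row i M) = 0 \<longrightarrow> (\<forall>i. c i = 0)"
  proof (intro allI impI)
    fix c :: "'n \<Rightarrow> 'a" and i
    assume 0: "(\<Sum>i\<in>UNIV. c i *s row i M) = 0"
    define f where "f = (\<lambda>v. c (inv (\<lambda>i. row i M) v))"
    have f: "f (row i M) = c i" for i unfolding f_def by (simp add: inv_f_f[OF inj])
    have "(\<Sum>v\<in>rows M. f v *s v) = 0"
      unfolding rows by (subst sum.reindex[OF inj]) (simp add: f 0)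
    then have "f (row i M) = 0"
      using vec.independentD[OF ind _ order_refl, of f "row i M"] by (simp add: rows)
    then show "c i = 0" by (simp add: f)
  qed
next
  assume ker: "\<forall>c. (\<Sum>i\<in>UNIV. c i *s row i M) = 0 \<longrightarrow> (\<forall>i. c i = 0)"
  have rows: "rows M = range (\<lambda>i. row i M)" by (auto simp: rows_def)
  have inj: "inj (\<lambda>i. row i M)"
  proof (rule injI, rule ccontr)
    fix i j assume e: "row i M = row j M" and ne: "i \<noteq> j"
    define c where "c k = (if k = i then 1 else if k = j then - 1 else 0 :: 'a)" for k
    have "(\<Sum>k\<in>UNIV. c k *s row k M) = (\<Sum>k\<in>{i, j}. c k *s row k M)"
      by (rule sum.mono_neutral_right) (auto simp: c_def)
    also have "\<dots> = 0" using ne e by (simp add: c_def)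
    finally have "c i = 0" using ker by blast
    then show False by (simp add: c_def)
  qed
  have "vec.independent (rows M)"
  proof (rule vec.independent_if_scalars_zero)
    fix f v assume 0: "(\<Sum>v\<in>rows M. f v *s v) = 0" and v: "v \<in> rows M"
    have "(\<Sum>i\<in>UNIV. f (row i M) *s row i M) = 0"
      using 0 unfolding rows by (subst (asm) sum.reindex[OF inj]) simp
    then show "f v = 0" using ker v by (auto simp: rows)
  qed (simp add: rows)
  then show "rank M = CARD('n)"
    by (simp add: row_rank_def_gen vec.dim_eq_card_independent rows card_image inj)
qed

text \<open>Exchanging the sums shows that a relation between the rows is a functional vanishing on
  the range of \<open>M\<close>; axes suffice as tests.\<close>

lemma left_kernel_mv:
  fixes M :: "'a::field^'m^'n"
  shows "(\<Sum>i\<in>UNIV. c i *s row i M) = 0 \<longleftrightarrow> (\<forall>z. (\<Sum>i\<in>UNIV. c i * (M *v z) $ i) = 0)"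
proof -
  have eq: "(\<Sum>i\<in>UNIV. c i * (M *v z) $ i) = (\<Sum>j\<in>UNIV. (\<Sum>i\<in>UNIV. c i *s row i M) $ j * z $ j)" for z
    unfolding matrix_vector_mult_def
    by (simp add: row_def sum_distrib_left sum_distrib_right mult.assoc) (rule sum.swap)
  show ?thesis
  proof
    assume "\<forall>z. (\<Sum>i\<in>UNIV. c i * (M *v z) $ i) = 0"
    then have "(\<Sum>j\<in>UNIV. (\<Sum>i\<in>UNIV. c i *s row i M) $ j * axis k 1 $ j) = 0" for k
      unfolding eq by blast
    then show "(\<Sum>i\<in>UNIV. c i *s row i M) = 0"
      by (simp add: vec_eq_iff axis_def if_distrib cong: if_cong)
  qed (simp add: eq)
qed

lemma mat_mv: "mat z *v x = z *s (x :: 'a::semiring_1^'n)"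
  by (simp add: vec_eq_iff matrix_vector_mult_def mat_def if_distrib if_distribR cong: if_cong)

lemma full_rank_imp_surj:
  fixes M :: "'a::field^'m^'n"
  assumes "rank M = CARD('n)"
  shows "\<exists>z. M *v z = y"
  using assms unfolding rank_eq_rows_iff matrix_right_invertible_independent_rows[symmetric]
    matrix_right_invertible_surjective by (metis surjD)

text \<open>A left null vector \<open>c\<close> gives a functional \<open>l\<close> blind to inputs.
  Every two steps, its value on the conjugated state is multiplied by \<open>z\<close>, so it cannot
  decay when \<open>cmod z \<ge> 1\<close> unless it is \<open>0\<close>.\<close>

lemma stabilizable_imp_rank_cond:
  fixes A :: "complex^'n^'n" and B :: "complex^'m^'n"
  assumes "stabilizable A B"
  shows "stabilizability_rank_cond A B"
  unfolding stabilizability_rank_cond_def rank_eq_rows_iff left_kernel_mv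
proof (intro allI impI)
  fix z :: complex and c :: "'n \<Rightarrow> complex" and i
  assume z: "1 \<le> cmod z"
  define l where "l y = (\<Sum>i\<in>UNIV. c i * y $ i)" for y :: "complex^'n"
  assume "\<forall>w. (\<Sum>i\<in>UNIV. c i * (hblock (hblock (mat z - A ** mcnj A) B) (A ** mcnj B) *v w) $ i) = 0"
  then have ker: "l (hblock (hblock (mat z - A ** mcnj A) B) (A ** mcnj B) *v vjoin (vjoin y v) w) = 0"
    for y v w unfolding l_def by blast
  have l_add: "l (x + y) = l x + l y" and l_smult: "l (a *s x) = a * l x" and l_diff: "l (x - y) = l x - l y"
    and l_0: "l 0 = 0" for x y a
    by (simp_all add: l_def distrib_left right_diff_distrib sum.distrib sum_subtractf sum_distrib_left mult_ac)
  have lB: "l (B *v v) = 0" and lAB: "l (A *v (mcnj B *v v)) = 0" for v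
    using ker[of 0 v 0] ker[of 0 0 v] by (simp_all add: hblock_mv matrix_vector_mul_assoc)
  have lA: "l (A *v (mcnj A *v y)) = z * l y" for y
    using ker[of y 0 0]
    by (simp add: hblock_mv matrix_vector_mult_diff_rdistrib mat_mv l_diff l_smult matrix_vector_mul_assoc)
  obtain K1 K2 where "asymptotically_stable (closed_loop A B (\<lambda>x. K1 *v x + mcnj K2 *v vcnj x))"
    using assms by (auto simp: stabilizable_def)
  then obtain F where F: "asymptotically_stable (closed_loop A B F)" by blast
  have "l y = 0" for y
  proof -
    \<comment> \<open>The start \<open>vcnj y\<close> makes the conjugated initial state equal to
      the arbitrary vector \<open>y\<close>.\<close>
    define x where "x k = (closed_loop A B F ^^ k) (vcnj y)" for k
    have "x \<longlonglongrightarrow> 0" using F by (simp add: asymptotically_stable_def x_def[abs_def])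
    then have "(\<lambda>k. x (2 * k)) \<longlonglongrightarrow> 0"
      by (rule LIMSEQ_subseq_LIMSEQ[unfolded o_def]) (simp add: strict_mono_def)
    then have "(\<lambda>k. l (vcnj (x (2 * k)))) \<longlonglongrightarrow> l (vcnj 0)"
      unfolding l_def vcnj_def vec_lambda_beta by (intro tendsto_intros)
    then have lim: "(\<lambda>k. cmod (l (vcnj (x (2 * k))))) \<longlonglongrightarrow> 0"
      by (simp add: l_0 tendsto_norm_zero)
    have step: "vcnj (x (Suc k)) = A *v x k + B *v F (x k)" for k
      by (simp add: x_def closed_loop_def antilin_step_vcnj)
    have x_Suc: "x (Suc k) = mcnj A *v vcnj (x k) + mcnj B *v vcnj (F (x k))" for k
      by (simp add: x_def closed_loop_def antilin_step_def)
    have "l (vcnj (x (Suc (Suc k)))) = z * l (vcnj (x k))" for k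
      unfolding step[of "Suc k"] x_Suc[of k]
      by (simp add: l_add lB lAB lA matrix_vector_right_distrib)
    then have "cmod (l (vcnj (x (2 * k)))) \<ge> cmod (l y)" for k
    proof (induction k)
      case (Suc k)
      have "1 * cmod (l (vcnj (x (2 * k)))) \<le> cmod z * cmod (l (vcnj (x (2 * k))))"
        using z by (intro mult_right_mono) auto
      with Suc show ?case by (simp add: norm_mult)
    qed (simp add: x_def)
    then have "cmod (l y) \<le> 0" using LIMSEQ_le_const[OF lim] by blast
    then show "l y = 0" by simp
  qed
  from this[of "axis i 1"] show "c i = 0"
    by (simp add: l_def axis_def if_distrib cong: if_cong)
qed

section \<open>Quotients by subspaces\<close>

text \<open>A left inverse of the identity on \<open>X\<close> with values in \<open>X\<close>; such
  projections replace the formation of quotient spaces.\<close>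

lemma subspace_projection:
  fixes X :: "'a::real_vector set"
  assumes "subspace X"
  obtains \<pi> where "linear \<pi>" "\<And>x. \<pi> x \<in> X" "\<And>x. x \<in> X \<Longrightarrow> \<pi> x = x"
  using real_vector.linear_exists_left_inverse_on[OF linear_id assms] by auto

text \<open>Dimension count: modulo \<open>Y\<close>, the map \<open>\<phi>\<close> has kernel
  inside \<open>X\<close>, so the codimension of \<open>Y\<close> is at least that of
  \<open>X\<close>.\<close>

lemma subspace_eq_if_preimage_subset:
  fixes \<phi> :: "'a::euclidean_space \<Rightarrow> 'a"
  assumes \<phi>: "linear \<phi>" and X: "subspace X" and Y: "subspace Y" and XY: "X \<subseteq> Y"
    and pre: "\<And>x. \<phi> x \<in> Y \<Longrightarrow> x \<in> X"
  shows "Y = X"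
proof -
  obtain \<pi> where \<pi>: "linear \<pi>" "\<And>x. \<pi> x \<in> X" "\<And>x. x \<in> X \<Longrightarrow> \<pi> x = x"
    using subspace_projection[OF X] by metis
  obtain \<rho> where \<rho>: "linear \<rho>" "\<And>x. \<rho> x \<in> Y" "\<And>x. x \<in> Y \<Longrightarrow> \<rho> x = x"
    using subspace_projection[OF Y] by metis
  \<comment> \<open>Up to the choice of complements, \<open>T\<close> is the sum of the identity of \<open>X\<close> and the map
    induced by \<open>\<phi>\<close> from the quotient by \<open>X\<close> to the quotient by \<open>Y\<close>.\<close>
  define T where "T x = \<pi> x + (\<phi> x - \<rho> (\<phi> x))" for x
  have T: "linear T"
    unfolding T_def using \<pi>(1) \<rho>(1) \<phi>
    by (intro linear_compose_add linear_compose_sub) (simp_all add: linear_compose[unfolded o_def])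
  have key: "\<phi> x \<in> Y" if "T x \<in> Y" for x
  proof -
    have "T x - \<pi> x \<in> Y" using that \<pi>(2) XY Y by (meson subspace_diff subsetD)
    then have "T x - \<pi> x + \<rho> (\<phi> x) \<in> Y" using \<rho>(2) Y by (meson subspace_add)
    then show ?thesis by (simp add: T_def)
  qed
  have "inj T"
  proof (subst linear_injective_0[OF T], intro allI impI)
    fix x assume 0: "T x = 0"
    then have "\<phi> x \<in> Y" using key Y by (simp add: subspace_0)
    then have "\<pi> x = 0" "x \<in> X" using 0 pre by (simp_all add: T_def \<rho>(3))
    then show "x = 0" using \<pi>(3) by simp
  qed
  then have "surj T" using T by (rule linear_inj_imp_surj[rotated])
  \<comment> \<open>Where \<open>T\<close> takes a value in \<open>Y\<close>, its second summand
    vanishes, so the value lies in the range of \<open>\<pi>\<close>.\<close>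
  have "y \<in> X" if y: "y \<in> Y" for y
  proof -
    obtain x where x: "y = T x" using \<open>surj T\<close> by (auto simp: surj_def)
    then have "\<phi> x \<in> Y" using y key by simp
    then have "y = \<pi> x" by (simp add: x T_def \<rho>(3))
    then show ?thesis using \<pi>(2) by simp
  qed
  then show ?thesis using XY by blast
qed

text \<open>On the finite-dimensional quotient by \<open>X\<close>, a surjective endomorphism is
  injective. \<open>T\<close> realizes this on the whole space, as the identity on \<open>X\<close>
  and the map induced by \<open>L\<close> on a complement.\<close>

lemma quotient_surj_imp_inj:
  fixes L :: "'a::euclidean_space \<Rightarrow> 'a"
  assumes L: "linear L" and X: "subspace X" and inv: "\<And>x. x \<in> X \<Longrightarrow> L x \<in> X"
    and surj: "\<And>y. \<exists>a. y - L a \<in> X" and r: "L r \<in> X"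
  shows "r \<in> X"
proof -
  obtain \<pi> where \<pi>: "linear \<pi>" "\<And>x. \<pi> x \<in> X" "\<And>x. x \<in> X \<Longrightarrow> \<pi> x = x"
    using subspace_projection[OF X] by metis
  define T where "T x = \<pi> x + (L x - \<pi> (L x))" for x
  have T: "linear T"
    unfolding T_def using \<pi>(1) L
    by (intro linear_compose_add linear_compose_sub) (simp_all add: linear_compose[unfolded o_def])
  have TX: "T x = x" if "x \<in> X" for x using that by (simp add: T_def \<pi>(3) inv)
  have Tc: "T (a - \<pi> a) = L a - \<pi> (L a)" for a
  proof -
    have "T (a - \<pi> a) = T a - T (\<pi> a)" using T by (rule linear_diff)
    also have "T (\<pi> a) = \<pi> a" by (simp add: TX \<pi>(2))
    finally show ?thesis by (simp add: T_def)
  qed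
  have "\<exists>x. y = T x" for y
  proof -
    obtain a where a: "y - L a \<in> X" using surj by blast
    have T_eq: "T (a - \<pi> a + \<pi> y) = L a - \<pi> (L a) + \<pi> y"
      using linear_add[OF T] by (simp add: Tc TX \<pi>(2))
    have "y - L a = \<pi> y - \<pi> (L a)"
      using \<pi>(3)[OF a] linear_diff[OF \<pi>(1)] by simp
    then have "L a - \<pi> (L a) + \<pi> y = y" by (simp add: algebra_simps)
    with T_eq have "T (a - \<pi> a + \<pi> y) = y" by (rule trans)
    then show ?thesis by metis
  qed
  then have "inj T" using linear_surj_imp_inj[OF T] by (simp add: surj_def)
  moreover have "T (r - \<pi> r) = 0" by (simp add: Tc \<pi>(3) r)
  ultimately have "r - \<pi> r = 0" using linear_injective_0[OF T] by blast
  then show "r \<in> X" using \<pi>(2)[of r] by simp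
qed

text \<open>The vector \<open>q(M) p\<close>, expanded in the iterates of \<open>p\<close>.\<close>

definition poly_act :: "complex^'n^'n \<Rightarrow> complex^'n \<Rightarrow> complex poly \<Rightarrow> complex^'n" where
  "poly_act M p q = (\<Sum>i\<le>degree q. coeff q i *s ((*v) M ^^ i) p)"

lemma poly_act_bound:
  "degree q \<le> N \<Longrightarrow> poly_act M p q = (\<Sum>i\<le>N. coeff q i *s ((*v) M ^^ i) p)"
  unfolding poly_act_def by (rule sum.mono_neutral_left) (auto simp: coeff_eq_0)

lemma poly_act_add: "poly_act M p (q + r) = poly_act M p q + poly_act M p r"
proof -
  define N where "N = max (degree q) (degree r)"
  have "degree q \<le> N" "degree r \<le> N" "degree (q + r) \<le> N"
    by (simp_all add: N_def degree_add_le)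
  then show ?thesis
    by (simp add: poly_act_bound[of _ N] sum.distrib vector_sadd_rdistrib)
qed

lemma poly_act_smult: "poly_act M p (smult a q) = a *s poly_act M p q"
  using poly_act_bound[OF degree_smult_le[of a q], of M p]
  by (simp add: poly_act_def[of M p q] vec.scale_sum_right vector_smult_assoc)

lemma mv_sum: "M *v sum f S = (\<Sum>i\<in>S. M *v f i)"
  by (induction S rule: infinite_finite_induct) (simp_all add: matrix_vector_right_distrib)

lemma poly_act_pCons_0: "poly_act M p (pCons 0 q) = M *v poly_act M p q"
proof -
  have "degree (pCons 0 q) \<le> Suc (degree q)" by (rule degree_pCons_le)
  from poly_act_bound[OF this]
  have "poly_act M p (pCons 0 q) = (\<Sum>i\<le>degree q. coeff q i *s (M *v ((*v) M ^^ i) p))"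
    unfolding sum.atMost_Suc_shift by simp
  also have "\<dots> = M *v poly_act M p q"
    by (simp add: poly_act_def mv_sum mv_smult)
  finally show ?thesis .
qed

lemma poly_act_linear_factor:
  "poly_act M p ([:- z, 1:] * q) = M *v poly_act M p q - z *s poly_act M p q"
proof -
  have "[:- z, 1:] * q = pCons 0 q + smult (- z) q" by simp
  then show ?thesis
    by (simp only: poly_act_add poly_act_smult poly_act_pCons_0) (simp add: vec_eq_iff)
qed

text \<open>The iterates of \<open>p\<close> lie in a finite-dimensional space. Dependence speaks of
  sets, so a repeated iterate is a separate case, settled by a difference of two monomials.\<close>

lemma annihilating_poly_exists: "\<exists>q. q \<noteq> 0 \<and> poly_act M p q = 0"
proof (cases "inj (\<lambda>i. ((*v) M ^^ i) p)")
  case True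
  let ?v = "\<lambda>i. ((*v) M ^^ i) p"
  have "\<not> finite (range ?v)" using True by (simp add: finite_image_iff)
  then have "vec.dependent (range ?v)" using vec.finiteI_independent by blast
  then obtain t f w where t: "finite t" "t \<subseteq> range ?v" "w \<in> t" "f w \<noteq> 0" "(\<Sum>v\<in>t. f v *s v) = 0"
    unfolding vec.dependent_explicit by blast
  define I where "I = ?v -` t"
  have tI: "t = ?v ` I" using t(2) by (auto simp: I_def)
  have I: "finite I" unfolding I_def by (rule finite_vimageI[OF t(1) True])
  define q where "q = (\<Sum>i\<in>I. monom (f (?v i)) i)"
  have c: "coeff q i = (if i \<in> I then f (?v i) else 0)" for i
    using I by (simp add: q_def coeff_sum if_distrib if_distribR sum.delta cong: if_cong)
  obtain N where N: "I \<subseteq> {..N}" using I finite_nat_set_iff_bounded_le by auto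
  have "degree q \<le> N" using N by (intro degree_le) (auto simp: c)
  then have "poly_act M p q = (\<Sum>i\<le>N. coeff q i *s ?v i)" by (rule poly_act_bound)
  also have "\<dots> = (\<Sum>i\<in>I. f (?v i) *s ?v i)"
    using N by (intro sum.mono_neutral_cong_right) (auto simp: c)
  also have "\<dots> = 0"
    using t(5) unfolding tI by (subst (asm) sum.reindex) (use True in \<open>auto intro: inj_on_subset\<close>)
  finally have "poly_act M p q = 0" .
  moreover obtain j where "j \<in> I" "w = ?v j" using t(3) tI by auto
  then have "q \<noteq> 0" using t(4) c[of j] by auto
  ultimately show ?thesis by blast
next
  case False
  then obtain i j where ij: "i < j" "((*v) M ^^ i) p = ((*v) M ^^ j) p"
    by (auto simp: inj_def) (metis linorder_neqE_nat)
  define q where "q = monom (1 :: complex) j + smult (- 1) (monom 1 i)"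
  have m: "poly_act M p (monom 1 k) = ((*v) M ^^ k) p" for k
  proof -
    have "poly_act M p (monom 1 k) = (\<Sum>i\<le>k. (if i = k then 1 else 0) *s ((*v) M ^^ i) p)"
      by (simp add: poly_act_def degree_monom_eq eq_commute)
    also have "\<dots> = (\<Sum>i\<in>{k}. 1 *s ((*v) M ^^ i) p)"
      by (rule sum.mono_neutral_cong_right) auto
    finally show ?thesis by simp
  qed
  have "poly_act M p q = 0"
    unfolding q_def poly_act_add poly_act_smult m using ij by (simp add: vec_eq_iff)
  moreover have "coeff q j \<noteq> 0" using ij by (simp add: q_def)
  then have "q \<noteq> 0" by auto
  ultimately show ?thesis by blast
qed

lemma quotient_eigenvector:
  fixes M :: "complex^'n^'n"
  assumes X0: "0 \<in> X" and Xs: "\<And>c x. x \<in> X \<Longrightarrow> c *s x \<in> X" and p: "p \<notin> X"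
  obtains r z where "r \<notin> X" "M *v r - z *s r \<in> X"
proof -
  \<comment> \<open>Take a polynomial of least degree sending \<open>p\<close> into \<open>X\<close> and split off a root.\<close>
  define P where "P n \<longleftrightarrow> (\<exists>q. q \<noteq> 0 \<and> degree q = n \<and> poly_act M p q \<in> X)" for n
  have "\<exists>n. P n" using annihilating_poly_exists[of M p] X0 unfolding P_def by metis
  then obtain n where n: "P n" "\<And>k. k < n \<Longrightarrow> \<not> P k" using exists_least_iff[of P] by blast
  then obtain q where q: "q \<noteq> 0" "degree q = n" "poly_act M p q \<in> X" by (auto simp: P_def)
  have "n \<noteq> 0"
  proof
    assume "n = 0"
    then have "coeff q 0 \<noteq> 0" and a: "coeff q 0 *s p \<in> X"
      using q leading_coeff_neq_0[OF q(1)] by (simp_all add: poly_act_def)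
    then show False using Xs[OF a, of "inverse (coeff q 0)"] p by (simp add: vector_smult_assoc)
  qed
  then obtain z where "poly q z = 0"
    using fundamental_theorem_of_algebra[of q] q(2) by (auto simp: constant_degree)
  then obtain s where s: "q = [:- z, 1:] * s" by (auto simp: poly_eq_0_iff_dvd)
  have "s \<noteq> 0" using q(1) s by auto
  then have "degree s < n" using q(2) unfolding s by (subst (asm) degree_mult_eq) auto
  then have "poly_act M p s \<notin> X" using n(2) \<open>s \<noteq> 0\<close> by (auto simp: P_def)
  moreover have "M *v poly_act M p s - z *s poly_act M p s \<in> X"
    using q(3) by (simp only: s poly_act_linear_factor)
  ultimately show ?thesis by (rule that)
qed

section \<open>Geometric decay\<close>

text \<open>A rate is part of the notion, since convergence alone would not give square
  summability.\<close>

definition geometric_decay :: "(nat \<Rightarrow> 'a::real_normed_vector) \<Rightarrow> bool" where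
  "geometric_decay f \<longleftrightarrow> (\<exists>C \<rho>. 0 \<le> \<rho> \<and> \<rho> < 1 \<and> (\<forall>k. norm (f k) \<le> C * \<rho> ^ k))"

lemma geometric_decayI:
  assumes "\<And>k. norm (f k) \<le> C * \<rho> ^ k" "0 < \<rho>" "\<rho> < 1"
  shows "geometric_decay f"
  unfolding geometric_decay_def using assms by (intro exI[of _ C] exI[of _ \<rho>]) simp

text \<open>The rate can be worsened to exceed any prescribed \<open>r < 1\<close>, by moving
  halfway to \<open>1\<close>; this allows two sequences to share a rate.\<close>

lemma geometric_decayE:
  assumes "geometric_decay f" "0 \<le> r" "r < 1"
  obtains \<rho> C where "r < \<rho>" "\<rho> < 1" "0 \<le> C" "\<forall>k. norm (f k) \<le> C * \<rho> ^ k"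
proof -
  obtain C s where s: "0 \<le> s" "s < 1" "\<And>k. norm (f k) \<le> C * s ^ k"
    using assms(1) unfolding geometric_decay_def by blast
  have C: "0 \<le> C" using order_trans[OF norm_ge_zero s(3)[of 0]] by simp
  define \<rho> where "\<rho> = (max s r + 1) / 2"
  have \<rho>: "r < \<rho>" "\<rho> < 1" "s \<le> \<rho>" using s assms(3) by (auto simp: \<rho>_def)
  have "norm (f k) \<le> C * \<rho> ^ k" for k
    using s(3)[of k] mult_left_mono[OF power_mono[OF \<rho>(3) s(1), of k] C] by linarith
  then show ?thesis using that \<rho> C by blast
qed

lemma geometric_decay_mono:
  assumes "geometric_decay f" "\<And>k. norm (g k) \<le> M * norm (f k)"
  shows "geometric_decay g"
proof -
  obtain C \<rho> where d: "0 < \<rho>" "\<rho> < 1" "0 \<le> C" "\<forall>k. norm (f k) \<le> C * \<rho> ^ k"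
    by (rule geometric_decayE[OF assms(1) order_refl zero_less_one])
  have "norm (g k) \<le> (\<bar>M\<bar> * C) * \<rho> ^ k" for k
  proof -
    have "norm (g k) \<le> \<bar>M\<bar> * norm (f k)"
      using assms(2)[of k] by (meson abs_ge_self mult_right_mono norm_ge_zero order_trans)
    also have "\<dots> \<le> \<bar>M\<bar> * (C * \<rho> ^ k)" using d(4) by (intro mult_left_mono) auto
    finally show ?thesis by (simp add: mult.assoc)
  qed
  then show ?thesis using d(1,2) by (rule geometric_decayI)
qed

lemma geometric_decay_add:
  assumes "geometric_decay f" "geometric_decay g"
  shows "geometric_decay (\<lambda>k. f k + g k)"
proof -
  obtain C \<rho> where f: "0 < \<rho>" "\<rho> < 1" "0 \<le> C" "\<forall>k. norm (f k) \<le> C * \<rho> ^ k"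
    by (rule geometric_decayE[OF assms(1) order_refl zero_less_one])
  obtain D \<sigma> where g: "\<rho> < \<sigma>" "\<sigma> < 1" "0 \<le> D" "\<forall>k. norm (g k) \<le> D * \<sigma> ^ k"
    by (rule geometric_decayE[OF assms(2) less_imp_le[OF f(1)] f(2)])
  have \<sigma>: "0 < \<sigma>" using f(1) g(1) by simp
  have "norm (f k + g k) \<le> (C + D) * \<sigma> ^ k" for k
  proof -
    have "C * \<rho> ^ k \<le> C * \<sigma> ^ k" using f g by (intro mult_left_mono power_mono) auto
    then show ?thesis
      using norm_triangle_ineq[of "f k" "g k"] f(4)[rule_format, of k] g(4)[rule_format, of k]
      by (simp add: distrib_right)
  qed
  then show ?thesis using \<sigma> g(2) by (rule geometric_decayI)
qed

lemma geometric_decay_prepend: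
  assumes "geometric_decay (\<lambda>k. f (Suc k))"
  shows "geometric_decay f"
proof -
  obtain C \<rho> where f: "0 < \<rho>" "\<rho> < 1" "0 \<le> C" "\<forall>k. norm (f (Suc k)) \<le> C * \<rho> ^ k"
    by (rule geometric_decayE[OF assms order_refl zero_less_one])
  \<comment> \<open>\<open>C / \<rho>\<close> makes up for the index shift; the maximum covers the
    new first term.\<close>
  define D where "D = max (norm (f 0)) (C / \<rho>)"
  have "norm (f k) \<le> D * \<rho> ^ k" for k
  proof (cases k)
    case (Suc j)
    have "C * \<rho> ^ j = (C / \<rho>) * \<rho> ^ k" using f(1) Suc by simp
    also have "\<dots> \<le> D * \<rho> ^ k" using f(1) by (intro mult_right_mono) (auto simp: D_def)
    finally show ?thesis using f(4)[rule_format, of j] Suc by simp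
  qed (simp add: D_def)
  then show ?thesis using f(1,2) by (rule geometric_decayI)
qed

lemma geometric_decay_Suc:
  assumes "geometric_decay f"
  shows "geometric_decay (\<lambda>k. f (Suc k))"
proof -
  obtain C \<rho> where f: "0 < \<rho>" "\<rho> < 1" "0 \<le> C" "\<forall>k. norm (f k) \<le> C * \<rho> ^ k"
    by (rule geometric_decayE[OF assms order_refl zero_less_one])
  have "norm (f (Suc k)) \<le> (C * \<rho>) * \<rho> ^ k" for k
    using f(4)[rule_format, of "Suc k"] by (simp add: mult.assoc)
  then show ?thesis using f(1,2) by (rule geometric_decayI)
qed

text \<open>Two steps contract by \<open>m\<close>, so one step by \<open>sqrt m\<close>; a rate of
  the forcing term above \<open>sqrt m\<close> is inherited.\<close>

lemma geometric_decay_recurrence: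
  assumes y: "geometric_decay y" and m: "0 \<le> m" "m < 1"
    and rec: "\<And>k. norm (s (Suc (Suc k))) \<le> m * norm (s k) + norm (y k)"
  shows "geometric_decay s"
proof -
  have m1: "0 \<le> sqrt m" "sqrt m < 1" using m by simp_all
  obtain C \<rho> where d: "sqrt m < \<rho>" "\<rho> < 1" "0 \<le> C" "\<forall>k. norm (y k) \<le> C * \<rho> ^ k"
    by (rule geometric_decayE[OF y m1])
  have \<rho>: "0 < \<rho>" using m1(1) d(1) by (rule le_less_trans)
  have "(sqrt m)\<^sup>2 < \<rho>\<^sup>2" using d(1) m by (intro power_strict_mono) auto
  then have m\<rho>: "m < \<rho>\<^sup>2" using m by simp
  \<comment> \<open>Large enough for both initial terms and for
    \<open>m * D + C \<le> D * \<rho>\<^sup>2\<close>, which lets the induction absorb the forcing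
    term.\<close>
  define D where "D = max (norm (s 0)) (max (norm (s 1) / \<rho>) (C / (\<rho>\<^sup>2 - m)))"
  have "C / (\<rho>\<^sup>2 - m) \<le> D" by (simp add: D_def)
  then have D: "m * D + C \<le> D * \<rho>\<^sup>2" using m\<rho> by (simp add: field_simps)
  have "norm (s k) \<le> D * \<rho> ^ k" for k
  proof (induction k rule: induct_nat_012)
    case 0
    show ?case by (simp add: D_def)
  next
    case 1
    have "norm (s 1) / \<rho> \<le> D" by (simp add: D_def)
    then show ?case using \<rho> by (simp add: field_simps)
  next
    case (ge2 n)
    have "norm (s (Suc (Suc n))) \<le> m * (D * \<rho> ^ n) + C * \<rho> ^ n"
      using rec[of n] mult_left_mono[OF ge2(1) m(1)] d(4)[rule_format, of n] by linarith
    also have "\<dots> = (m * D + C) * \<rho> ^ n" by (simp add: algebra_simps)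
    also have "\<dots> \<le> (D * \<rho>\<^sup>2) * \<rho> ^ n" using D \<rho> by (intro mult_right_mono) auto
    finally show ?case by (simp add: power2_eq_square mult_ac)
  qed
  then show ?thesis using \<rho> d(2) by (rule geometric_decayI)
qed

lemma geometric_decay_summable_square:
  assumes "geometric_decay f"
  shows "summable (\<lambda>k. (norm (f k))\<^sup>2)"
proof -
  obtain C \<rho> where f: "0 < \<rho>" "\<rho> < 1" "0 \<le> C" "\<forall>k. norm (f k) \<le> C * \<rho> ^ k"
    by (rule geometric_decayE[OF assms order_refl zero_less_one])
  have "\<rho>\<^sup>2 < 1" using f by (simp add: power_less_one_iff)
  then have "summable (\<lambda>k. C\<^sup>2 * (\<rho>\<^sup>2) ^ k)"
    by (intro summable_mult summable_geometric) simp
  then show ?thesis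
  proof (rule summable_comparison_test_ev[rotated], intro always_eventually allI)
    fix k
    have "(norm (f k))\<^sup>2 \<le> (C * \<rho> ^ k)\<^sup>2" using f(4) by (intro power_mono) auto
    then show "norm ((norm (f k))\<^sup>2) \<le> C\<^sup>2 * (\<rho>\<^sup>2) ^ k"
      by (simp add: power_mult_distrib power_mult[symmetric] mult.commute)
  qed
qed

text \<open>The factor varies with \<open>k\<close> because conjugation makes it alternate between a
  number and its conjugate.\<close>

fun two_step_recursion ::
  "(nat \<Rightarrow> complex) \<Rightarrow> complex^'k \<Rightarrow> complex^'k \<Rightarrow> (nat \<Rightarrow> complex^'k) \<Rightarrow> nat \<Rightarrow> complex^'k" where
  "two_step_recursion d a b y 0 = a"
| "two_step_recursion d a b y (Suc 0) = b"
| "two_step_recursion d a b y (Suc (Suc k)) = d k *s two_step_recursion d a b y k + y k"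

lemma two_step_recursion_decay:
  assumes "geometric_decay y" "m < 1" "\<And>k. cmod (d k) = m"
  shows "geometric_decay (two_step_recursion d a b y)"
proof (rule geometric_decay_recurrence[OF assms(1) _ assms(2)])
  show "0 \<le> m" using assms(3)[of 0] norm_ge_zero[of "d 0"] by simp
  show "norm (two_step_recursion d a b y (Suc (Suc k))) \<le>
      m * norm (two_step_recursion d a b y k) + norm (y k)" for k
    using norm_triangle_ineq[of "d k *s two_step_recursion d a b y k" "y k"]
    by (simp add: norm_smult assms(3))
qed

section \<open>The rank condition is sufficient\<close>

locale antilinear_system =
  fixes A :: "complex^'n^'n" and B :: "complex^'m^'n"
begin

abbreviation step :: "complex^'n \<Rightarrow> complex^'m \<Rightarrow> complex^'n" where
  "step \<equiv> antilin_step A B"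

text \<open>The control must decay too, so that steering has finite cost.\<close>

definition decaying :: "(nat \<Rightarrow> complex^'n) \<Rightarrow> (nat \<Rightarrow> complex^'m) \<Rightarrow> bool" where
  "decaying x u \<longleftrightarrow> (\<forall>k. x (Suc k) = step (x k) (u k)) \<and> geometric_decay x \<and> geometric_decay u"

definition steerable :: "(complex^'n) set" where
  "steerable = {x 0 |x. \<exists>u. decaying x u}"

lemma steerableI: "decaying x u \<Longrightarrow> x 0 = y \<Longrightarrow> y \<in> steerable"
  by (auto simp: steerable_def)

lemma steerableE:
  assumes "y \<in> steerable"
  obtains x u where "decaying x u" "x 0 = y"
  using assms by (auto simp: steerable_def)

lemma step_add: "step (x + y) (u + v) = step x u + step y v"
  by (simp add: antilin_step_vcnj matrix_vector_right_distrib vcnj_add)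

lemma step_smult: "step (c *s x) (c *s u) = cnj c *s step x u"
  by (simp add: antilin_step_vcnj mv_smult vcnj_add vcnj_smult vector_add_ldistrib)

lemma step_split: "step x u = step x 0 + step 0 u"
  using step_add[of x 0 0 u] by simp

lemma zero_steerable: "0 \<in> steerable"
  by (rule steerableI[of "\<lambda>_. 0" "\<lambda>_. 0"])
    (auto simp: decaying_def geometric_decay_def antilin_step_vcnj intro!: exI[of _ 0])

lemma steerable_add:
  assumes "y \<in> steerable" "z \<in> steerable"
  shows "y + z \<in> steerable"
proof -
  obtain x u where x: "decaying x u" "x 0 = y" using assms(1) by (rule steerableE)
  obtain x' u' where x': "decaying x' u'" "x' 0 = z" using assms(2) by (rule steerableE)
  have "decaying (\<lambda>k. x k + x' k) (\<lambda>k. u k + u' k)"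
    using x(1) x'(1) by (simp add: decaying_def geometric_decay_add step_add)
  then show ?thesis by (rule steerableI) (simp add: x x')
qed

lemma steerable_smult:
  assumes "y \<in> steerable"
  shows "c *s y \<in> steerable"
proof -
  obtain x u where x: "decaying x u" "x 0 = y" using assms by (rule steerableE)
  \<comment> \<open>A step is conjugate-homogeneous, so the multiplier must alternate between
    \<open>c\<close> and its conjugate.\<close>
  define d where "d k = (if even k then c else cnj c)" for k :: nat
  have "cmod (d k) = cmod c" for k by (simp add: d_def)
  then have "geometric_decay (\<lambda>k. d k *s x k)" "geometric_decay (\<lambda>k. d k *s u k)"
    using x(1) by (auto simp: decaying_def norm_smult intro: geometric_decay_mono[where M = "cmod c"])
  moreover have "d (Suc k) *s step (x k) (u k) = step (d k *s x k) (d k *s u k)" for k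
    by (simp add: step_smult d_def)
  ultimately have "decaying (\<lambda>k. d k *s x k) (\<lambda>k. d k *s u k)"
    using x(1) by (simp add: decaying_def)
  then show ?thesis by (rule steerableI) (simp add: x d_def)
qed

lemma subspace_steerable: "subspace steerable"
proof (rule subspaceI)
  fix c y assume "y \<in> steerable"
  from steerable_smult[OF this, of "of_real c"]
  have "complex_of_real c *s y \<in> steerable" .
  also have "complex_of_real c *s y = c *\<^sub>R y"
    by (simp add: vec_eq_iff) (simp add: scaleR_conv_of_real)
  finally show "c *\<^sub>R y \<in> steerable" .
qed (simp_all add: zero_steerable steerable_add)

lemma steerable_step_back:
  assumes "step y v \<in> steerable"
  shows "y \<in> steerable"
proof -
  obtain x u where x: "decaying x u" "x 0 = step y v" using assms by (rule steerableE)
  have "decaying (case_nat y x) (case_nat v u)"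
    using x unfolding decaying_def
    by (auto intro: geometric_decay_prepend split: nat.split)
  then show ?thesis by (rule steerableI) simp
qed

lemma steerable_step_forward:
  assumes "y \<in> steerable"
  shows "\<exists>v. step y v \<in> steerable"
proof -
  obtain x u where x: "decaying x u" "x 0 = y" using assms by (rule steerableE)
  have "decaying (\<lambda>k. x (Suc k)) (\<lambda>k. u (Suc k))"
    using x(1) unfolding decaying_def by (intro conjI geometric_decay_Suc) simp_all
  then have "x (Suc 0) \<in> steerable" by (rule steerableI) simp
  then show ?thesis using x by (auto simp: decaying_def)
qed

lemma linear_step: "linear (\<lambda>x. step x 0)" "linear (step 0)"
proof -
  have s: "step (r *\<^sub>R x) (r *\<^sub>R u) = r *\<^sub>R step x u" for r x u
  proof -
    have e: "of_real r *s w = r *\<^sub>R w" for w :: "complex^'k"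
      by (simp add: vec_eq_iff) (simp add: scaleR_conv_of_real)
    show ?thesis using step_smult[of "of_real r" x u] by (simp add: e)
  qed
  show "linear (\<lambda>x. step x 0)"
  proof (rule linearI)
    show "step (x + y) 0 = step x 0 + step y 0" for x y using step_add[of x y 0 0] by simp
    show "step (r *\<^sub>R x) 0 = r *\<^sub>R step x 0" for r x using s[of r x 0] by simp
  qed
  show "linear (step 0)"
  proof (rule linearI)
    show "step 0 (u + v) = step 0 u + step 0 v" for u v using step_add[of 0 0 u v] by simp
    show "step 0 (r *\<^sub>R u) = r *\<^sub>R step 0 u" for r u using s[of r 0 u] by simp
  qed
qed

text \<open>The drift induces an injection from the quotient by \<open>steerable\<close> into the quotient by
  \<open>steerable\<close> plus the range of the input map, so these two subspaces have the same dimension.\<close>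

lemma steerable_invariant: "step 0 v \<in> steerable" "y \<in> steerable \<Longrightarrow> step y 0 \<in> steerable"
proof -
  define Y where "Y = {x + step 0 v |x v. x \<in> steerable}"
  have "subspace (range (step 0))"
    using linear_subspace_image[OF linear_step(2) subspace_UNIV] .
  moreover have "Y = {x + y |x y. x \<in> steerable \<and> y \<in> range (step 0)}" by (auto simp: Y_def)
  ultimately have subY: "subspace Y" using subspace_sums[OF subspace_steerable] by simp
  have neg: "step 0 (- v) = - step 0 v" for v using linear_neg[OF linear_step(2)] .
  have "Y = steerable"
  proof (rule subspace_eq_if_preimage_subset[OF linear_step(1) subspace_steerable subY])
    have "step 0 0 = 0" using linear_0[OF linear_step(2)] .
    then have "x = x + step 0 0" for x by simp
    then show "steerable \<subseteq> Y" unfolding Y_def by blast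
    fix x assume "step x 0 \<in> Y"
    then obtain z v where z: "step x 0 = z + step 0 v" "z \<in> steerable" by (auto simp: Y_def)
    \<comment> \<open>The control \<open>- v\<close> removes the input part and leaves a steerable
      next state.\<close>
    have "step x (- v) = z" unfolding step_split[of x "- v"] z(1) by (simp add: neg)
    then have "step x (- v) \<in> steerable" using z(2) by simp
    then show "x \<in> steerable" by (rule steerable_step_back)
  qed
  moreover have "0 + step 0 v \<in> Y" using zero_steerable unfolding Y_def by blast
  ultimately show "step 0 v \<in> steerable" by simp
  assume "y \<in> steerable"
  then obtain v where "step y v \<in> steerable" using steerable_step_forward by blast
  then have "step y v + step 0 (- v) \<in> Y" unfolding Y_def by blast
  also have "step y v + step 0 (- v) = step y 0" unfolding step_split[of y v] by (simp add: neg)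
  finally show "step y 0 \<in> steerable" unfolding \<open>Y = steerable\<close> .
qed


text \<open>From \<open>r\<close> the uncontrolled system reaches after two steps \<open>z *s r\<close> plus a steerable vector, which
  is then steered by its own control; iterating leaves the remainder \<open>z ^ k *s r\<close>, up to conjugation.\<close>

lemma steerable_if_contracted:
  assumes z: "cmod z < 1" and r: "step (step r 0) 0 - z *s r \<in> steerable"
  shows "r \<in> steerable"
proof -
  obtain y v where y: "decaying y v" "y 0 = step (step r 0) 0 - z *s r"
    using r by (rule steerableE)
  define d where "d k = (if even k then z else cnj z)" for k :: nat
  define s where "s = two_step_recursion d r (step r 0) y"
  \<comment> \<open>The first two steps are uncontrolled, hence the zero initial values.\<close>
  define w where "w = two_step_recursion d 0 0 v"
  have d: "cmod (d k) = cmod z" "cnj (d k) = d (Suc k)" for k by (simp_all add: d_def)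
  have "s (Suc k) = step (s k) (w k)" for k
  proof (induction k rule: induct_nat_012)
    case (ge2 n)
    have "step (s (Suc (Suc n))) (w (Suc (Suc n))) =
        step (d n *s s n) (d n *s w n) + step (y n) (v n)"
      by (simp add: s_def w_def step_add)
    also have "\<dots> = d (Suc n) *s s (Suc n) + y (Suc n)"
      using y(1) by (simp add: step_smult d ge2(1) decaying_def)
    finally show ?case by (simp add: s_def)
  qed (simp_all add: s_def w_def y d_def)
  moreover have "geometric_decay s" "geometric_decay w"
    unfolding s_def w_def using y(1) z d(1)
    by (auto simp: decaying_def intro: two_step_recursion_decay)
  ultimately have "decaying s w" by (simp add: decaying_def)
  then show ?thesis by (rule steerableI) (simp add: s_def)
qed

lemma rank_cond_imp_steerable:
  assumes rank: "stabilizability_rank_cond A B"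
  shows "steerable = UNIV"
proof (rule ccontr)
  assume "steerable \<noteq> UNIV"
  then obtain p where "p \<notin> steerable" by blast
  then obtain r z where r: "r \<notin> steerable" and rz: "(mcnj A ** A) *v r - z *s r \<in> steerable"
    using quotient_eigenvector[of steerable p "mcnj A ** A"] zero_steerable steerable_smult by blast
  have two: "step (step x 0) 0 = (mcnj A ** A) *v x" for x
    by (simp add: antilin_step_vcnj vcnj_mv mcnj_mult matrix_vector_mul_assoc)
  have "cmod z \<ge> 1" using steerable_if_contracted[of z r] r rz unfolding two by (meson not_less)
  define L where "L x = (mcnj A ** A) *v x - z *s x" for x
  \<comment> \<open>Modulo \<open>steerable\<close>, the map \<open>L\<close> kills
    \<open>r\<close>; the rank condition makes \<open>L\<close> surjective there, hence injective,
    contrary to the choice of \<open>r\<close>.\<close>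
  have "r \<in> steerable"
  proof (rule quotient_surj_imp_inj[of L, OF _ subspace_steerable])
    show "linear L"
    proof (rule linearI)
      show "L (x + y) = L x + L y" for x y
        by (simp add: L_def matrix_vector_right_distrib vector_add_ldistrib)
      show "L (c *\<^sub>R x) = c *\<^sub>R L x" for c x
        by (simp add: L_def linear_scale[OF matrix_vector_mul_linear] scaleR_right_diff_distrib)
          (simp add: vec_eq_iff)
    qed
    show "L x \<in> steerable" if "x \<in> steerable" for x
      unfolding L_def two[symmetric] using that
      by (intro subspace_diff[OF subspace_steerable] steerable_invariant steerable_smult)
    show "L r \<in> steerable" using rz by (simp add: L_def)
    fix y
    \<comment> \<open>Conjugation turns \<open>A ** mcnj A\<close> into the two-step drift
      \<open>mcnj A ** A\<close> and an eigenvalue into its conjugate, so the condition is applied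
      at \<open>cnj z\<close>.\<close>
    have "rank (hblock (hblock (mat (cnj z) - A ** mcnj A) B) (A ** mcnj B)) = CARD('n)"
      using rank \<open>cmod z \<ge> 1\<close> by (simp add: stabilizability_rank_cond_def)
    then obtain w where w: "hblock (hblock (mat (cnj z) - A ** mcnj A) B) (A ** mcnj B) *v w = vcnj y"
      using full_rank_imp_surj by blast
    obtain w' c where w': "w = vjoin w' c" by (rule vjoin_cases)
    obtain a b where ab: "w' = vjoin a b" by (rule vjoin_cases)
    have y: "vcnj y = cnj z *s a - A *v (mcnj A *v a) + B *v b + A *v (mcnj B *v c)"
      using w by (simp add: w' ab hblock_mv matrix_vector_mult_diff_rdistrib mat_mv
          matrix_vector_mul_assoc)
    have "y = z *s vcnj a - mcnj A *v (A *v vcnj a)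
        + vcnj (B *v b) + mcnj A *v (B *v vcnj c)"
      using arg_cong[OF y, of vcnj]
      by (simp add: vcnj_add vcnj_diff vcnj_smult vcnj_mv)
    moreover have "L (- vcnj a) = z *s vcnj a - mcnj A *v (A *v vcnj a)"
      by (simp add: L_def vec.neg matrix_vector_mul_assoc)
    moreover have "step 0 b = vcnj (B *v b)" "step (step 0 (vcnj c)) 0 = mcnj A *v (B *v vcnj c)"
      by (simp_all add: antilin_step_vcnj vcnj_mv)
    \<comment> \<open>The input columns contribute only states reachable from \<open>0\<close> in
      one or two steps, which are steerable.\<close>
    ultimately have "y - L (- vcnj a) = step 0 b + step (step 0 (vcnj c)) 0" by simp
    also have "\<dots> \<in> steerable"
      by (intro steerable_add steerable_invariant)
    finally show "\<exists>a. y - L a \<in> steerable" by blast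
  qed
  with r show False by simp
qed

end

context antilinear_lqr
begin

lemma rank_cond_imp_finite_cost:
  assumes "stabilizability_rank_cond A B"
  shows "\<exists>u. cost x0 u < top"
proof -
  interpret antilinear_system A B .
  have "x0 \<in> steerable" using rank_cond_imp_steerable[OF assms] by simp
  then obtain x u where xu: "decaying x u" "x 0 = x0" by (rule steerableE)
  have traj: "traj A B x0 u k = x k" for k
    using xu by (induction k) (simp_all add: decaying_def)
  define a where "a = (\<Sum>i\<in>UNIV. \<Sum>j\<in>UNIV. cmod (Q $ i $ j))"
  define b where "b = (\<Sum>i\<in>UNIV. \<Sum>j\<in>UNIV. cmod (R $ i $ j))"
  have "summable (stages x0 u)"
  proof (rule summable_comparison_test_ev, intro always_eventually allI)
    show "norm (stages x0 u k) \<le> a * (norm (x k))\<^sup>2 + b * (norm (u k))\<^sup>2" for k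
      using order_trans[OF complex_Re_le_cmod sesq_norm_le[of Q "x k"]]
        order_trans[OF complex_Re_le_cmod sesq_norm_le[of R "u k"]] stage_nonneg[of "x k" "u k"]
      by (simp add: traj) (simp add: stage_def a_def b_def)
    show "summable (\<lambda>k. a * (norm (x k))\<^sup>2 + b * (norm (u k))\<^sup>2)"
      using xu(1) unfolding decaying_def
      by (intro summable_add summable_mult geometric_decay_summable_square) simp_all
  qed
  then have "cost x0 u < top" using cost_finite_iff by blast
  then show ?thesis by blast
qed

lemma fixpoint_imp_stabilizable:
  assumes "pos_def P" "riccati P = P"
  shows "stabilizable A B"
proof -
  have eq: "(\<lambda>x. K1_opt A B Q R P *v x + mcnj 0 *v vcnj x) = (\<lambda>x. K1_opt A B Q R P *v x)"
    by (auto simp: vec_eq_iff matrix_vector_mult_def)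
  show ?thesis
    unfolding stabilizable_def
    by (intro exI[of _ "K1_opt A B Q R P"] exI[of _ 0], subst eq) (rule closed_loop_stable[OF assms])
qed

end

section \<open>Equivalence of the conditions and the optimal feedback\<close>

theorem theorem3:
  fixes A2 :: "complex^'n^'n" and B2 :: "complex^'m^'n"
    and Q :: "complex^'n^'n" and R :: "complex^'m^'m"
  assumes "pos_def Q" and "pos_def R"
  shows "(lqr_solvable A2 B2 Q R \<longleftrightarrow> stabilizable A2 B2)
    \<and> (stabilizable A2 B2 \<longleftrightarrow> stabilizability_rank_cond A2 B2)
    \<and> (stabilizable A2 B2 \<longleftrightarrow> (\<exists>!P. pos_def P \<and> normal_riccati A2 B2 Q R P))
    \<and> (lqr_solvable A2 B2 Q R \<longrightarrow>
        (\<forall>P_N. pos_def P_N \<and> normal_riccati A2 B2 Q R P_N \<longrightarrow>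
          (\<forall>x0 u. lqr_optimal A2 B2 Q R x0 u \<longleftrightarrow>
                   (\<forall>k. u k = K1_opt A2 B2 Q R P_N *v traj A2 B2 x0 u k))
          \<and> asymptotically_stable (closed_loop A2 B2 (\<lambda>x. K1_opt A2 B2 Q R P_N *v x))
          \<and> (\<forall>x0 u. lqr_optimal A2 B2 Q R x0 u \<longrightarrow>
                   lqr_cost A2 B2 Q R x0 u = ennreal (Re (sesq P_N x0)))))"
proof -
  interpret antilinear_lqr A2 B2 Q R by unfold_locales (fact assms)+
  \<comment> \<open>Every condition is compared with a single statement, the existence of a positive
    definite fixed point of \<open>riccati\<close>.\<close>
  have sol: "pos_def P \<and> normal_riccati A2 B2 Q R P \<longleftrightarrow> pos_def P \<and> riccati P = P" for P
    by (rule conj_cong[OF refl normal_riccati_iff_fixpoint])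
  have fixpoint_unique: "P = P'"
    if "pos_def P" "riccati P = P" "pos_def P'" "riccati P' = P'" for P P'
    by (rule two_step_solution_unique) (simp_all add: that)
  have stab_rank: "stabilizability_rank_cond A2 B2" if "stabilizable A2 B2"
    using that by (rule stabilizable_imp_rank_cond)
  have rank_fix: "\<exists>P. pos_def P \<and> riccati P = P" if "stabilizability_rank_cond A2 B2"
    using riccati_fixpoint_exists[OF rank_cond_imp_finite_cost[OF that]] by blast
  have fix_solv: "lqr_solvable A2 B2 Q R" if "pos_def P" "riccati P = P" for P
  proof -
    have "riccati (riccati P) = P" using that by simp
    from optimal_exists[OF that(1) this]
    have "\<exists>u. lqr_optimal A2 B2 Q R x0 u \<and> cost x0 u < \<infinity>" for x0
      by (metis ennreal_less_top infinity_ennreal_def)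
    then show ?thesis by (simp add: lqr_solvable_def)
  qed
  have solv_fix: "\<exists>P. pos_def P \<and> riccati P = P" if "lqr_solvable A2 B2 Q R"
  proof -
    have "\<exists>u. cost x0 u < top" for x0 using that by (auto simp: lqr_solvable_def)
    from riccati_fixpoint_exists[OF this] show ?thesis by blast
  qed
  have "stabilizable A2 B2 \<longleftrightarrow> (\<exists>P. pos_def P \<and> riccati P = P)"
    using fixpoint_imp_stabilizable rank_fix stab_rank by blast
  moreover have "lqr_solvable A2 B2 Q R \<longleftrightarrow> (\<exists>P. pos_def P \<and> riccati P = P)"
    using fix_solv solv_fix by blast
  moreover have "stabilizability_rank_cond A2 B2 \<longleftrightarrow> (\<exists>P. pos_def P \<and> riccati P = P)"
    using fixpoint_imp_stabilizable rank_fix stab_rank by blast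
  moreover have "(\<exists>!P. pos_def P \<and> normal_riccati A2 B2 Q R P) \<longleftrightarrow> (\<exists>P. pos_def P \<and> riccati P = P)"
    unfolding sol using fixpoint_unique by blast
  moreover have "(\<forall>x0 u. lqr_optimal A2 B2 Q R x0 u \<longleftrightarrow>
        (\<forall>k. u k = K1_opt A2 B2 Q R P *v traj A2 B2 x0 u k))
      \<and> asymptotically_stable (closed_loop A2 B2 (\<lambda>x. K1_opt A2 B2 Q R P *v x))
      \<and> (\<forall>x0 u. lqr_optimal A2 B2 Q R x0 u \<longrightarrow> cost x0 u = ennreal (Re (sesq P x0)))"
    if "pos_def P \<and> normal_riccati A2 B2 Q R P" for P
  proof -
    from that have P: "pos_def P" "riccati P = P" unfolding sol by simp_all
    then have "riccati (riccati P) = P" by simp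
    with P show ?thesis
      using optimal_iff_feedback[OF P] closed_loop_stable[OF P] optimal_cost[OF P(1)] by blast
  qed
  ultimately show ?thesis by blast
qed

end
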